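(* Let $\alpha>0$ and let $\mu$ be a probability measure on $[0,\infty)$ with $\mu([x,\infty)) = \exp(-F(x))$, where $F$ is a strictly increasing smoothly varying function with index $\beta$, $0<\beta < \tfrac12$. Then for every $c>0$, $$\lim_{t \to \infty} P_\mu\left(X_t > \frac{c}{F'(\alpha t)} \;\middle|\; \tau > t\right) = e^{-c}.$$
   Context: $X=(X_t:t\ge 0)$ is Brownian motion with constant negative drift $-\alpha$ ($\alpha>0$) on $[0,\infty)$, absorbed at $0$; that is, $X_t=X_0+B_t-\alpha t$ up to the hitting time $\tau=\inf\{t\ge 0: X_t=0\}$, with $B$ a standard Brownian motion started at $0$ and independent of $X_0$, and $X_t=0$ for $t\ge\tau$. $P_\mu$ denotes the law of the process when $X_0$ has distribution $\mu$. A function $F$, positive on a neighbourhood of infinity, is smoothly varying with index $\beta$ (in the sense of Bingham--Goldie--Teugels) if $h(x)=\ln F(e^x)$ is $C^\infty$ on a neighbourhood of infinity with $h'(x)\to\beta$ and $h^{(n)}(x)\to 0$ for every $n\ge 2$ as $x\to\infty$. *)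

theory Defs
  imports "HOL-Probability.Probability"
begin

text \<open>
  Standard Brownian motion, indexed by the real numbers of which only the times
  \<open>t \<ge> 0\<close> matter. All sample paths are continuous, so that first
  hitting times are measurable; the start at the origin is only required almost surely.
\<close>

locale brownian_motion = prob_space M
  for M :: "'a measure" and B :: "real \<Rightarrow> 'a \<Rightarrow> real" +
  assumes random_variable_B: "\<And>t. 0 \<le> t \<Longrightarrow> B t \<in> borel_measurable M"
    and start_B: "AE \<omega> in M. B 0 \<omega> = 0"
    and continuous_B: "\<And>\<omega>. \<omega> \<in> space M \<Longrightarrow> continuous_on {0..} (\<lambda>t. B t \<omega>)"
    and increment_B: "\<And>s t. 0 \<le> s \<Longrightarrow> s < t \<Longrightarrow>
      distributed M lborel (\<lambda>\<omega>. B t \<omega> - B s \<omega>) (normal_density 0 (sqrt (t - s)))"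
    and indep_increments_B: "\<And>(u :: nat \<Rightarrow> real) n.
      0 \<le> u 0 \<Longrightarrow> (\<And>i. i < n \<Longrightarrow> u i < u (Suc i)) \<Longrightarrow>
      indep_vars (\<lambda>_. borel) (\<lambda>i \<omega>. B (u (Suc i)) \<omega> - B (u i) \<omega>) {..<n}"

definition drifted :: "real \<Rightarrow> ('a \<Rightarrow> real) \<Rightarrow> (real \<Rightarrow> 'a \<Rightarrow> real) \<Rightarrow> real \<Rightarrow> 'a \<Rightarrow> real" where
  "drifted \<alpha> X0 B t \<omega> = X0 \<omega> + B t \<omega> - \<alpha> * t"

text \<open>The value is \<open>\<infinity>\<close> on paths that never visit the origin.\<close>

definition hitting_time_0 :: "(real \<Rightarrow> 'a \<Rightarrow> real) \<Rightarrow> 'a \<Rightarrow> ereal" where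
  "hitting_time_0 Y \<omega> = Inf {ereal t | t. 0 \<le> t \<and> Y t \<omega> = 0}"

definition absorbed_at_0 :: "(real \<Rightarrow> 'a \<Rightarrow> real) \<Rightarrow> real \<Rightarrow> 'a \<Rightarrow> real" where
  "absorbed_at_0 Y t \<omega> = (if ereal t < hitting_time_0 Y \<omega> then Y t \<omega> else 0)"

text \<open>
  Absorption does not change the first visit to the origin, so the absorption time of
  the absorbed process is \<^term>\<open>hitting_time_0 (drifted \<alpha> X0 B)\<close>.
\<close>

definition smoothly_varying :: "real \<Rightarrow> (real \<Rightarrow> real) \<Rightarrow> bool" where
  "smoothly_varying \<beta> F \<longleftrightarrow>
    (\<forall>\<^sub>F x in at_top. F x > 0) \<and>
    (let h = (\<lambda>x. ln (F (exp x))) in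
      (\<exists>a. \<forall>n. \<forall>x>a. (deriv ^^ n) h differentiable (at x)) \<and>
      (deriv h \<longlongrightarrow> \<beta>) at_top \<and>
      (\<forall>n\<ge>2. ((deriv ^^ n) h \<longlongrightarrow> 0) at_top))"

end

theory Submission
  imports Defs "HOL-Real_Asymp.Real_Asymp"
begin

text \<open>
  To survive up to a large time \<open>t\<close>, the process uses its heavy-tailed start rather than its noise:
  conditionally on survival \<open>X0\<close> exceeds \<open>\<alpha> * t\<close>, and the Brownian motion behaves as usual, with
  displacements of order \<open>sqrt t\<close>. Write \<open>w = 1 / deriv F (\<alpha> * t)\<close> for the scale of the overshoot of
  \<open>X0\<close> above \<open>\<alpha> * t\<close>. Since \<open>F\<close> varies smoothly, \<open>F (\<alpha> * t + \<kappa> * w) - F (\<alpha> * t)\<close> tends to \<open>\<kappa>\<close>, so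
  the overshoot in units of \<open>w\<close> is asymptotically standard exponential. The index satisfies
  \<open>\<beta> < 1 / 2\<close>, which makes \<open>w\<close> much larger than \<open>sqrt t\<close>; hence the noise does not change the
  overshoot on the scale \<open>w\<close>.

  The quantitative statement is \<open>survival_asymptotics\<close>: the probability that the process survives
  up to time \<open>t\<close> and then exceeds \<open>\<kappa> * w\<close> is asymptotic to \<open>exp (- F (\<alpha> * t)) * exp (- \<kappa>)\<close>. The
  conditional probability of the theorem is the quotient of the cases \<open>\<kappa> = c\<close> and \<open>\<kappa> = 0\<close>.
  For both bounds fix \<open>\<delta> > 0\<close>, put \<open>b = \<delta> * w\<close>, and let \<open>\<delta>\<close> tend to \<open>0\<close> at the end.

  For the lower bound (\<open>survival_lower_bound\<close>) it suffices that \<open>X0\<close> is at least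
  \<open>\<alpha> * t + \<kappa> * w + 2 * b\<close> while \<open>B\<close> stays above \<open>- b\<close> on \<open>{0..t}\<close>. These events are independent, and
  by Levy's maximal inequality the second has probability close to 1.

  For the upper bound (\<open>exceedance_upper_bound\<close>) survival is dropped, and the event
  \<open>X0 + B t > \<alpha> * t + \<kappa> * w\<close> is split by the size of \<open>B t\<close>. If \<open>B t \<le> b\<close>, then \<open>X0\<close> exceeds
  \<open>\<alpha> * t + (\<kappa> - \<delta>) * w\<close>. If \<open>b < B t \<le> \<alpha> * t / 2\<close>, the linear bound
  \<open>F (x - y) \<ge> F x - 2 * deriv F x * y\<close> turns the gain of a favourable displacement into an
  exponential moment of the Gaussian variable \<open>B t\<close> over \<open>B t > b\<close>, which vanishes as
  \<open>deriv F (\<alpha> * t) * sqrt t\<close> tends to \<open>0\<close>. The plain Gaussian tail would not be enough here: for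
  \<open>\<beta> > 1 / 3\<close>, \<open>exp (- b\<^sup>2 / (2 * t))\<close> is much larger than \<open>exp (- F (\<alpha> * t))\<close>.
  If \<open>B t > \<alpha> * t / 2\<close>, the Gaussian tail is exponentially small in \<open>t\<close>, while \<open>F\<close> is sublinear.
\<close>

section \<open>Limits of real functions\<close>

lemma filterlim_at_top_if_deriv_tendsto_pos:
  fixes g g' :: "real \<Rightarrow> real"
  assumes der: "\<forall>\<^sub>F x in at_top. (g has_real_derivative g' x) (at x)"
    and lim: "(g' \<longlongrightarrow> l) at_top" and "l > 0"
  shows "filterlim g at_top at_top"
proof -
  have "\<forall>\<^sub>F x in at_top. g' x > l / 2"
    using lim \<open>l > 0\<close> by (intro order_tendstoD) auto
  with der have "\<forall>\<^sub>F x in at_top. (g has_real_derivative g' x) (at x) \<and> g' x > l / 2"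
    by eventually_elim auto
  then obtain a where a: "\<And>x. x \<ge> a \<Longrightarrow> (g has_real_derivative g' x) (at x) \<and> g' x > l / 2"
    by (auto simp: eventually_at_top_linorder)
  have *: "g a - l / 2 * a + l / 2 * x \<le> g x" if "x \<ge> a" for x
  proof -
    have "g a - l / 2 * a \<le> g x - l / 2 * x"
    proof (rule DERIV_nonneg_imp_nondecreasing[OF that])
      fix y assume "a \<le> y" "y \<le> x"
      with a[of y] show "\<exists>d. ((\<lambda>x. g x - l / 2 * x) has_real_derivative d) (at y) \<and> 0 \<le> d"
        by (intro exI[of _ "g' y - l / 2"]) (auto intro!: derivative_eq_intros)
    qed
    then show ?thesis by simp
  qed
  have "filterlim (\<lambda>x. (g a - l / 2 * a) + l / 2 * x) at_top at_top"
    using \<open>l > 0\<close> by real_asymp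
  then show ?thesis
    by (rule filterlim_at_top_mono) (use * in \<open>auto simp: eventually_at_top_linorder\<close>)
qed

lemma squeeze_family:
  fixes f :: "'c \<Rightarrow> real"
  assumes "\<And>\<delta>. \<delta> > 0 \<Longrightarrow> (l \<delta> \<longlongrightarrow> L \<delta>) G" "\<And>\<delta>. \<delta> > 0 \<Longrightarrow> (u \<delta> \<longlongrightarrow> U \<delta>) G"
    and "\<And>\<delta>. \<delta> > 0 \<Longrightarrow> \<forall>\<^sub>F t in G. l \<delta> t \<le> f t \<and> f t \<le> u \<delta> t"
    and "(L \<longlongrightarrow> y) (at_right (0::real))" "(U \<longlongrightarrow> y) (at_right 0)"
  shows "(f \<longlongrightarrow> y) G"
proof (rule order_tendstoI)
  have pick: "\<exists>\<delta>>0. P \<delta>" if "\<forall>\<^sub>F \<delta> in at_right (0::real). P \<delta>" for P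
    using that unfolding eventually_at_right_field by (meson field_lbound_gt_zero)
  fix a
  {
    assume "a < y"
    then obtain \<delta> where "\<delta> > 0" "a < L \<delta>" using pick[OF order_tendstoD(1)[OF assms(4)]] by blast
    from order_tendstoD(1)[OF assms(1)[OF this(1)] this(2)] assms(3)[OF this(1)]
    show "\<forall>\<^sub>F t in G. a < f t" by eventually_elim auto
  next
    assume "y < a"
    then obtain \<delta> where "\<delta> > 0" "U \<delta> < a" using pick[OF order_tendstoD(2)[OF assms(5)]] by blast
    from order_tendstoD(2)[OF assms(2)[OF this(1)] this(2)] assms(3)[OF this(1)]
    show "\<forall>\<^sub>F t in G. f t < a" by eventually_elim auto
  }
qed

section \<open>The hazard rate of a smoothly varying exponent\<close>

text \<open>
  In the logarithmic variable, \<open>F (exp u) = exp (h u)\<close>, so the logarithm of \<open>deriv F (exp u)\<close> is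
  \<open>h u + ln (deriv h u) - u\<close>. Its slope is \<open>deriv h u - 1\<close> up to a term that vanishes with the second
  derivative of \<open>h\<close>.
\<close>

lemma smoothly_varying_log_deriv:
  assumes sv: "smoothly_varying \<beta> F" and "\<beta> > 0"
  obtains f' where
    "\<forall>\<^sub>F x in at_top. (F has_real_derivative deriv F x) (at x) \<and> deriv F x > 0"
    "\<forall>\<^sub>F u in at_top. ((\<lambda>u. ln (deriv F (exp u))) has_real_derivative f' u) (at u)"
    "(f' \<longlongrightarrow> \<beta> - 1) at_top"
proof -
  define h where "h = (\<lambda>x. ln (F (exp x)))"
  from sv obtain a where a: "\<And>n x. x > a \<Longrightarrow> (deriv ^^ n) h differentiable (at x)"
    and h1: "(deriv h \<longlongrightarrow> \<beta>) at_top" and hn: "\<And>n. n \<ge> 2 \<Longrightarrow> ((deriv ^^ n) h \<longlongrightarrow> 0) at_top"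
    and Fpos: "\<forall>\<^sub>F x in at_top. F x > 0"
    unfolding smoothly_varying_def Let_def h_def by blast
  have h2: "(deriv (deriv h) \<longlongrightarrow> 0) at_top"
    using hn[of 2] by (simp add: numeral_2_eq_2)
  have "\<forall>\<^sub>F u in at_top. F (exp u) > 0"
    using Fpos exp_at_top by (auto simp: filterlim_iff)
  moreover have "\<forall>\<^sub>F u in at_top. deriv h u > 0"
    using h1 \<open>\<beta> > 0\<close> by (intro order_tendstoD) auto
  moreover have "\<forall>\<^sub>F u in at_top. u > a" by (rule eventually_gt_at_top)
  ultimately have "\<forall>\<^sub>F u in at_top. F (exp u) > 0 \<and> deriv h u > 0 \<and> u > a"
    by eventually_elim auto
  then obtain b where b: "\<And>u. u \<ge> b \<Longrightarrow> F (exp u) > 0 \<and> deriv h u > 0 \<and> u > a"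
    by (auto simp: eventually_at_top_linorder)
  have dh: "(h has_real_derivative deriv h u) (at u)" if "u \<ge> b" for u
    using a[of u 0] b[OF that] DERIV_deriv_iff_real_differentiable by auto
  have ddh: "(deriv h has_real_derivative deriv (deriv h) u) (at u)" if "u \<ge> b" for u
    using a[of u 1] b[OF that] DERIV_deriv_iff_real_differentiable by auto
  have F_eq: "F x = exp (h (ln x))" if "x \<ge> exp b" for x
  proof -
    have "0 < x" using that exp_gt_zero[of b] by linarith
    with that have "ln x \<ge> b" by (simp add: ln_ge_iff)
    with b[of "ln x"] \<open>0 < x\<close> show ?thesis by (simp add: h_def)
  qed
  have dF: "(F has_real_derivative exp (h (ln x)) * deriv h (ln x) / x) (at x)" if "x > exp b" for x
  proof -
    have "0 < x" using that exp_gt_zero[of b] by linarith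
    with that have "ln x \<ge> b" by (simp add: ln_ge_iff)
    have "((\<lambda>x. exp (h (ln x))) has_real_derivative exp (h (ln x)) * deriv h (ln x) / x) (at x)"
      using dh[OF \<open>ln x \<ge> b\<close>] \<open>0 < x\<close>
      by (auto intro!: derivative_eq_intros DERIV_chain2[of h])
    then show ?thesis
      by (rule DERIV_cong_ev[THEN iffD1, rotated -1])
        (use F_eq that in \<open>auto intro!: eventually_mono[OF eventually_nhds_in_open[of "{exp b<..}"]]\<close>)
  qed
  have deriv_F: "deriv F x = exp (h (ln x)) * deriv h (ln x) / x" if "x > exp b" for x
    using dF[OF that] by (rule DERIV_imp_deriv)
  show ?thesis
  proof
    show "\<forall>\<^sub>F x in at_top. (F has_real_derivative deriv F x) (at x) \<and> deriv F x > 0"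
      using eventually_gt_at_top[of "exp b"]
    proof eventually_elim
      case (elim x)
      have "0 < x" using elim exp_gt_zero[of b] by linarith
      with elim have "ln x \<ge> b" by (simp add: ln_ge_iff)
      then show ?case using dF[OF elim] deriv_F[OF elim] b[of "ln x"] \<open>0 < x\<close> by simp
    qed
    show "\<forall>\<^sub>F u in at_top. ((\<lambda>u. ln (deriv F (exp u))) has_real_derivative
            deriv h u + deriv (deriv h) u / deriv h u - 1) (at u)"
      using eventually_gt_at_top[of b]
    proof eventually_elim
      case (elim u)
      have *: "ln (deriv F (exp v)) = h v + ln (deriv h v) - v" if "v > b" for v
        using b[of v] that by (simp add: deriv_F ln_mult ln_div)
      have "((\<lambda>v. h v + ln (deriv h v) - v) has_real_derivative
            deriv h u + deriv (deriv h) u / deriv h u - 1) (at u)"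
        using dh[of u] ddh[of u] b[of u] elim by (auto intro!: derivative_eq_intros)
      then show ?case
        by (rule DERIV_cong_ev[THEN iffD1, rotated -1])
          (use * elim in \<open>auto intro!: eventually_mono[OF eventually_nhds_in_open[of "{b<..}"]]\<close>)
    qed
    show "((\<lambda>u. deriv h u + deriv (deriv h) u / deriv h u - 1) \<longlongrightarrow> \<beta> - 1) at_top"
      using h1 h2 \<open>\<beta> > 0\<close> by (auto intro!: tendsto_eq_intros)
  qed
qed

text \<open>
  If a random variable has the tail \<open>exp (- F x)\<close>, then \<open>deriv F\<close> is its hazard rate. The two
  monotonicity conditions confine \<open>deriv F y / deriv F x\<close> between \<open>1\<close> and \<open>x / y\<close>, and thus replace
  all arguments about uniform convergence in regular variation. The two limits say that the
  overshoot scale \<open>1 / deriv F x\<close> is of larger order than \<open>sqrt x\<close> and of smaller order than \<open>x\<close>.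
\<close>

locale moderate_hazard =
  fixes F :: "real \<Rightarrow> real" and x0 :: real
  assumes x0_pos: "x0 > 0"
    and deriv_F: "\<And>x. x0 \<le> x \<Longrightarrow> (F has_real_derivative deriv F x) (at x)"
    and hazard_pos: "\<And>x. x0 \<le> x \<Longrightarrow> deriv F x > 0"
    and hazard_antimono: "\<And>x y. x0 \<le> x \<Longrightarrow> x \<le> y \<Longrightarrow> deriv F y \<le> deriv F x"
    and scaled_hazard_mono: "\<And>x y. x0 \<le> x \<Longrightarrow> x \<le> y \<Longrightarrow> x * deriv F x \<le> y * deriv F y"
    and scaled_hazard_at_top: "filterlim (\<lambda>x. x * deriv F x) at_top at_top"
    and sqrt_hazard_tendsto_0: "((\<lambda>x. sqrt x * deriv F x) \<longlongrightarrow> 0) at_top"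

text \<open>
  Every condition on the hazard rate is a statement about the slope of its logarithm in the
  logarithmic variable, and this slope tends to \<open>\<beta> - 1\<close>, a number strictly between \<open>- 1\<close> and \<open>- 1 / 2\<close>.
\<close>

lemma smoothly_varying_imp_moderate_hazard:
  assumes sv: "smoothly_varying \<beta> F" and "0 < \<beta>" "\<beta> < 1 / 2"
  obtains x0 where "moderate_hazard F x0"
proof -
  obtain f' where
    pos: "\<forall>\<^sub>F x in at_top. (F has_real_derivative deriv F x) (at x) \<and> deriv F x > 0"
    and der: "\<forall>\<^sub>F u in at_top. ((\<lambda>u. ln (deriv F (exp u))) has_real_derivative f' u) (at u)"
    and lim: "(f' \<longlongrightarrow> \<beta> - 1) at_top"
    using smoothly_varying_log_deriv[OF sv \<open>0 < \<beta>\<close>] .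
  define f where "f = (\<lambda>u. ln (deriv F (exp u)))"
  note der = der[folded f_def]
  have "\<forall>\<^sub>F u in at_top. f' u < 0" "\<forall>\<^sub>F u in at_top. f' u > -1"
    using lim assms(2,3) by (auto intro!: order_tendstoD)
  with der have "\<forall>\<^sub>F u in at_top. (f has_real_derivative f' u) (at u) \<and> f' u < 0 \<and> f' u > -1"
    by eventually_elim auto
  then obtain b where b: "\<And>u. u \<ge> b \<Longrightarrow> (f has_real_derivative f' u) (at u) \<and> f' u < 0 \<and> f' u > -1"
    by (auto simp: eventually_at_top_linorder)
  from pos obtain x1 where
    x1: "\<And>x. x \<ge> x1 \<Longrightarrow> (F has_real_derivative deriv F x) (at x) \<and> deriv F x > 0"
    by (auto simp: eventually_at_top_linorder)
  define x0 where "x0 = max x1 (exp b)"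
  have x0: "x0 > 0" "x0 \<ge> x1" "x0 \<ge> exp b"
    using exp_gt_zero[of b] by (auto simp: x0_def less_max_iff_disj simp del: exp_gt_zero)
  have haz: "deriv F x = exp (f (ln x))" if "x \<ge> x0" for x
    using x1[of x] x0 that by (simp add: f_def)
  have ln_ge: "ln x \<ge> b" if "x \<ge> x0" for x
    using that x0 by (simp add: ln_ge_iff)
  have f_anti: "f v \<le> f u" if "b \<le> u" "u \<le> v" for u v
    by (rule DERIV_nonpos_imp_nonincreasing[OF that(2)]) (use b that in \<open>meson less_imp_le order_trans\<close>)
  have f_mono: "f u + u \<le> f v + v" if "b \<le> u" "u \<le> v" for u v
  proof (rule DERIV_nonneg_imp_nondecreasing[OF that(2)])
    fix w assume "u \<le> w" "w \<le> v"
    with b[of w] that show "\<exists>d. ((\<lambda>w. f w + w) has_real_derivative d) (at w) \<and> 0 \<le> d"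
      by (intro exI[of _ "f' w + 1"]) (auto intro!: derivative_eq_intros)
  qed
  have lim1: "filterlim (\<lambda>u. f u + u) at_top at_top"
  proof (rule filterlim_at_top_if_deriv_tendsto_pos)
    show "\<forall>\<^sub>F u in at_top. ((\<lambda>u. f u + u) has_real_derivative f' u + 1) (at u)"
      using der by eventually_elim (auto intro!: derivative_eq_intros)
    show "((\<lambda>u. f' u + 1) \<longlongrightarrow> \<beta>) at_top" using lim by (auto intro!: tendsto_eq_intros)
  qed fact
  \<comment> \<open>Along \<open>x = exp u\<close> the quantity \<open>sqrt x * deriv F x\<close> is the exponential of \<open>f u + u / 2\<close>,
    whose slope tends to \<open>\<beta> - 1 / 2 < 0\<close>.\<close>
  have lim2: "filterlim (\<lambda>u. - (f u + u / 2)) at_top at_top"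
  proof (rule filterlim_at_top_if_deriv_tendsto_pos)
    show "\<forall>\<^sub>F u in at_top. ((\<lambda>u. - (f u + u / 2)) has_real_derivative - (f' u + 1 / 2)) (at u)"
      using der by eventually_elim (auto intro!: derivative_eq_intros)
    show "((\<lambda>u. - (f' u + 1 / 2)) \<longlongrightarrow> 1 / 2 - \<beta>) at_top" using lim by (auto intro!: tendsto_eq_intros)
  qed (use \<open>\<beta> < 1 / 2\<close> in simp)
  have "moderate_hazard F x0"
  proof
    show "0 < x0" by fact
    fix x assume "x0 \<le> x"
    with x0 x1[of x] show "(F has_real_derivative deriv F x) (at x)" "deriv F x > 0" by auto
  next
    fix x y assume xy: "x0 \<le> x" "x \<le> y"
    with x0 have "0 < x" "ln x \<le> ln y" by auto
    with xy ln_ge[of x] have "f (ln y) \<le> f (ln x)" and *: "f (ln x) + ln x \<le> f (ln y) + ln y"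
      by (auto intro!: f_anti f_mono)
    then show "deriv F y \<le> deriv F x" using xy haz by simp
    have "exp (f (ln x) + ln x) \<le> exp (f (ln y) + ln y)" using * by simp
    then show "x * deriv F x \<le> y * deriv F y"
      using xy haz[of x] haz[of y] \<open>0 < x\<close> by (simp add: exp_add mult.commute)
  next
    have "filterlim (\<lambda>x. exp (f (ln x) + ln x)) at_top at_top"
      by (intro filterlim_compose[OF exp_at_top] filterlim_compose[OF lim1] ln_at_top)
    then show "filterlim (\<lambda>x. x * deriv F x) at_top at_top"
      by (rule filterlim_cong[OF refl refl, THEN iffD1, rotated])
        (use eventually_ge_at_top[of x0] in eventually_elim, use x0 haz in \<open>auto simp: exp_add\<close>)
    have "((\<lambda>x. exp (- (- (f (ln x) + ln x / 2)))) \<longlongrightarrow> 0) at_top"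
      by (intro filterlim_compose[OF exp_at_bot] filterlim_compose[OF filterlim_uminus_at_bot_at_top]
          filterlim_compose[OF lim2] ln_at_top)
    then show "((\<lambda>x. sqrt x * deriv F x) \<longlongrightarrow> 0) at_top"
    proof (rule filterlim_cong[OF refl refl, THEN iffD1, rotated])
      show "\<forall>\<^sub>F x in at_top. exp (- (- (f (ln x) + ln x / 2))) = sqrt x * deriv F x"
        using eventually_ge_at_top[of x0]
      proof eventually_elim
        case (elim x)
        with x0 have "exp (ln x / 2) = sqrt x"
          by (simp add: powr_half_sqrt[symmetric] powr_def)
        with elim haz[of x] show ?case by (simp add: exp_add)
      qed
    qed
  qed
  then show ?thesis by (rule that)
qed

context moderate_hazard
begin

text \<open>
  By the mean value theorem, with hazard rate at most twice \<open>deriv F x\<close> on \<open>{x / 2..x}\<close> because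
  \<open>z * deriv F z\<close> increases.
\<close>

lemma exponent_lower_bound:
  assumes "2 * x0 \<le> x" "0 \<le> y" "y \<le> x / 2"
  shows "F x - 2 * deriv F x * y \<le> F (x - y)"
proof (cases "y = 0")
  case False
  with assms have "x - y < x" by simp
  have dF: "(F has_real_derivative deriv F z) (at z)" if "x - y \<le> z" for z
    by (rule deriv_F) (use assms that in simp)
  obtain z where z: "x - y < z" "z < x" and eq: "F x - F (x - y) = (x - (x - y)) * deriv F z"
    using MVT2[OF \<open>x - y < x\<close>, of F "deriv F"] dF by auto
  have x0z: "x0 \<le> z" using z assms by linarith
  have "x / 2 * deriv F z \<le> z * deriv F z"
    using z assms hazard_pos[OF x0z] by (intro mult_right_mono) auto
  also have "\<dots> \<le> x * deriv F x"
    using z x0z by (intro scaled_hazard_mono) auto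
  finally have "deriv F z \<le> 2 * deriv F x"
    using x0_pos assms by simp
  then have "y * deriv F z \<le> y * (2 * deriv F x)"
    using assms by (intro mult_left_mono) auto
  with eq show ?thesis by (simp add: algebra_simps)
qed simp

lemma scaled_hazard_step_tendsto_0: "((\<lambda>x. \<kappa> / deriv F x / x) \<longlongrightarrow> 0) at_top"
proof -
  have "((\<lambda>x. \<kappa> / (x * deriv F x)) \<longlongrightarrow> 0) at_top"
    by (rule tendsto_divide_0[OF tendsto_const])
      (rule filterlim_at_top_imp_at_infinity[OF scaled_hazard_at_top])
  then show ?thesis by (simp add: mult.commute)
qed

text \<open>
  The mean value theorem gives the increment as \<open>\<kappa> * deriv F z / deriv F x\<close>, where the relative distance
  of \<open>z\<close> from \<open>x\<close> is at most \<open>\<bar>\<kappa> / deriv F x / x\<bar>\<close>, and the monotonicity of \<open>deriv F z\<close> and of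
  \<open>z * deriv F z\<close> keeps the quotient of hazard rates equally close to \<open>1\<close>, up to a factor 2.
\<close>

lemma exponent_increment_tendsto:
  "((\<lambda>x. F (x + \<kappa> / deriv F x) - F x) \<longlongrightarrow> \<kappa>) at_top"
proof -
  let ?r = "\<lambda>x. \<kappa> / deriv F x / x"
  have bound: "\<bar>F (x + \<kappa> / deriv F x) - F x - \<kappa>\<bar> \<le> 2 * \<bar>\<kappa>\<bar> * \<bar>?r x\<bar>"
    if x: "2 * x0 \<le> x" and r: "\<bar>?r x\<bar> < 1 / 2" for x
  proof (cases "\<kappa> = 0")
    case False
    define v where "v = \<kappa> / deriv F x"
    define q where "q = \<bar>?r x\<bar>"
    have x': "0 < x" "x0 \<le> x" using x x0_pos by auto
    have p: "deriv F x > 0" by (rule hazard_pos) fact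
    have v: "\<bar>v\<bar> = q * x" "v \<noteq> 0" using x' False p by (auto simp: v_def q_def abs_mult)
    have q: "0 \<le> q" "q < 1 / 2" using r by (auto simp: q_def)
    have "q * x < 1 / 2 * x" using q x' by (intro mult_strict_right_mono) auto
    then have vx: "\<bar>v\<bar> < x / 2" using v by simp
    have "\<exists>z. min x (x + v) < z \<and> z < max x (x + v) \<and> F (x + v) - F x = v * deriv F z"
    proof (cases "v > 0")
      case True
      have "\<exists>z. x < z \<and> z < x + v \<and> F (x + v) - F x = (x + v - x) * deriv F z"
        by (rule MVT2) (use True x' deriv_F in auto)
      with True show ?thesis by auto
    next
      case neg: False
      have "\<exists>z. x + v < z \<and> z < x \<and> F x - F (x + v) = (x - (x + v)) * deriv F z"
        by (rule MVT2) (use neg v x vx in \<open>auto intro!: deriv_F\<close>)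
      then obtain z where "x + v < z" "z < x" "F x - F (x + v) = (x - (x + v)) * deriv F z" by blast
      with neg show ?thesis by (intro exI[of _ z]) auto
    qed
    then obtain z where z: "min x (x + v) < z" "z < max x (x + v)"
      and eq: "F (x + v) - F x = v * deriv F z" by blast
    have zx: "\<bar>z - x\<bar> \<le> q * x" using z v by auto
    have z0: "x0 \<le> z" "0 < z" using z vx x x0_pos by auto
    have "\<bar>deriv F z - deriv F x\<bar> \<le> 2 * q * deriv F x"
    proof (cases "x \<le> z")
      case True
      have "deriv F z \<le> deriv F x" using True x' by (intro hazard_antimono)
      have "x * deriv F x \<le> z * deriv F z" using True x' by (intro scaled_hazard_mono)
      also have "\<dots> = x * deriv F z + (z - x) * deriv F z" by (simp add: algebra_simps)
      also have "(z - x) * deriv F z \<le> (q * x) * deriv F x"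
        using zx True \<open>deriv F z \<le> deriv F x\<close> hazard_pos[OF z0(1)] by (intro mult_mono) auto
      finally have "x * deriv F x \<le> x * (deriv F z + q * deriv F x)" by (simp add: algebra_simps)
      then have "deriv F x \<le> deriv F z + q * deriv F x" using x' by simp
      moreover have "0 \<le> q * deriv F x" using q p by simp
      ultimately show ?thesis using \<open>deriv F z \<le> deriv F x\<close> by simp
    next
      case False
      then have "z \<le> x" by simp
      have "deriv F x \<le> deriv F z" using \<open>z \<le> x\<close> z0 by (intro hazard_antimono)
      have "x / 2 \<le> z" using zx \<open>q * x < 1 / 2 * x\<close> by auto
      have "z * deriv F z \<le> x * deriv F x" using \<open>z \<le> x\<close> z0 by (intro scaled_hazard_mono)
      then have "z * (deriv F z - deriv F x) \<le> (x - z) * deriv F x" by (simp add: algebra_simps)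
      also have "\<dots> \<le> (q * x) * deriv F x" using zx False p by (intro mult_right_mono) auto
      finally have *: "z * (deriv F z - deriv F x) \<le> q * x * deriv F x" .
      have "x / 2 * (deriv F z - deriv F x) \<le> z * (deriv F z - deriv F x)"
        using \<open>x / 2 \<le> z\<close> \<open>deriv F x \<le> deriv F z\<close> by (intro mult_right_mono) auto
      with * have "x * (deriv F z - deriv F x) \<le> x * (2 * q * deriv F x)" by (simp add: algebra_simps)
      then have "deriv F z - deriv F x \<le> 2 * q * deriv F x" using x' by simp
      with \<open>deriv F x \<le> deriv F z\<close> show ?thesis by simp
    qed
    then have "\<bar>v\<bar> * \<bar>deriv F z - deriv F x\<bar> \<le> \<bar>v\<bar> * (2 * q * deriv F x)"
      by (intro mult_left_mono) auto
    moreover have "v * deriv F x = \<kappa>" using p by (simp add: v_def)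
    moreover have "\<bar>v\<bar> * deriv F x = \<bar>\<kappa>\<bar>" using p by (simp add: v_def abs_mult)
    moreover have "\<bar>v\<bar> * (2 * q * deriv F x) = 2 * (\<bar>v\<bar> * deriv F x) * q" by simp
    moreover have "v * deriv F z - v * deriv F x = v * (deriv F z - deriv F x)"
      by (simp add: right_diff_distrib)
    ultimately have "\<bar>v * deriv F z - \<kappa>\<bar> \<le> 2 * \<bar>\<kappa>\<bar> * q"
      by (simp only: abs_mult)
    then show ?thesis by (simp add: eq[unfolded v_def] v_def q_def)
  qed simp
  have r0: "((\<lambda>x. \<bar>?r x\<bar>) \<longlongrightarrow> 0) at_top"
    using scaled_hazard_step_tendsto_0 by (rule tendsto_rabs_zero)
  have "\<forall>\<^sub>F x in at_top. \<bar>?r x\<bar> < 1 / 2" using r0 by (rule order_tendstoD) simp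
  with eventually_ge_at_top[of "2 * x0"]
  have "\<forall>\<^sub>F x in at_top. norm (F (x + \<kappa> / deriv F x) - F x - \<kappa>) \<le> 2 * \<bar>\<kappa>\<bar> * \<bar>?r x\<bar>"
    by eventually_elim (use bound in simp)
  moreover have "((\<lambda>x. 2 * \<bar>\<kappa>\<bar> * \<bar>?r x\<bar>) \<longlongrightarrow> 0) at_top"
    using tendsto_mult_right_zero[OF r0, of "2 * \<bar>\<kappa>\<bar>"] .
  ultimately have "((\<lambda>x. F (x + \<kappa> / deriv F x) - F x - \<kappa>) \<longlongrightarrow> 0) at_top"
    by (rule Lim_null_comparison)
  then show ?thesis by (simp add: LIM_zero_iff)
qed

lemma exponent_sublinear:
  assumes "\<epsilon> > 0"
  shows "filterlim (\<lambda>x. \<epsilon> * x - F x) at_top at_top"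
proof (rule filterlim_at_top_if_deriv_tendsto_pos)
  show "\<forall>\<^sub>F x in at_top. ((\<lambda>x. \<epsilon> * x - F x) has_real_derivative \<epsilon> - deriv F x) (at x)"
    using eventually_ge_at_top[of x0]
    by eventually_elim (auto intro!: derivative_eq_intros deriv_F)
  have "(deriv F \<longlongrightarrow> 0) at_top"
  proof (rule tendsto_sandwich[OF _ _ tendsto_const sqrt_hazard_tendsto_0])
    show "\<forall>\<^sub>F x in at_top. 0 \<le> deriv F x"
      using eventually_ge_at_top[of x0] by eventually_elim (use hazard_pos in \<open>auto intro: less_imp_le\<close>)
    show "\<forall>\<^sub>F x in at_top. deriv F x \<le> sqrt x * deriv F x"
      using eventually_ge_at_top[of "max 1 x0"]
    proof eventually_elim
      case (elim x)
      then have "1 \<le> sqrt x" "0 \<le> deriv F x" using hazard_pos[of x] by auto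
      then have "1 * deriv F x \<le> sqrt x * deriv F x" by (rule mult_right_mono)
      then show ?case by simp
    qed
  qed
  then show "((\<lambda>x. \<epsilon> - deriv F x) \<longlongrightarrow> \<epsilon>) at_top" by (auto intro!: tendsto_eq_intros)
qed fact

end

section \<open>Gaussian estimates\<close>

text \<open>
  On \<open>y > b\<close> the integrand is at most \<open>exp ((\<theta> + \<eta>) * y - \<eta> * b)\<close>, and multiplying a centred normal
  density by \<open>exp ((\<theta> + \<eta>) * y)\<close> only shifts its mean, at the price of the factor
  \<open>exp ((\<theta> + \<eta>)\<^sup>2 * \<sigma>\<^sup>2 / 2)\<close>.
\<close>

lemma nn_integral_exp_normal_tail:
  assumes \<sigma>: "\<sigma> > 0" and "\<eta> \<ge> 0"
  shows "(\<integral>\<^sup>+y. ennreal (exp (\<theta> * y)) * indicator {b<..} y \<partial>density lborel (normal_density 0 \<sigma>))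
    \<le> ennreal (exp ((\<theta> + \<eta>)\<^sup>2 * \<sigma>\<^sup>2 / 2 - \<eta> * b))"
proof -
  define \<rho> where "\<rho> = \<theta> + \<eta>"
  have tilt: "normal_density 0 \<sigma> y * exp (\<rho> * y) = exp (\<rho>\<^sup>2 * \<sigma>\<^sup>2 / 2) * normal_density (\<rho> * \<sigma>\<^sup>2) \<sigma> y" for y
  proof -
    have "- (y\<^sup>2) / (2 * \<sigma>\<^sup>2) + \<rho> * y = \<rho>\<^sup>2 * \<sigma>\<^sup>2 / 2 + - ((y - \<rho> * \<sigma>\<^sup>2)\<^sup>2) / (2 * \<sigma>\<^sup>2)"
      using \<sigma> by (simp add: field_simps power2_eq_square)
    then have "exp (- (y\<^sup>2) / (2 * \<sigma>\<^sup>2)) * exp (\<rho> * y)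
        = exp (\<rho>\<^sup>2 * \<sigma>\<^sup>2 / 2) * exp (- ((y - \<rho> * \<sigma>\<^sup>2)\<^sup>2) / (2 * \<sigma>\<^sup>2))"
      by (simp add: exp_add[symmetric])
    then show ?thesis by (simp add: normal_density_def)
  qed
  have "(\<integral>\<^sup>+y. ennreal (exp (\<theta> * y)) * indicator {b<..} y \<partial>density lborel (normal_density 0 \<sigma>))
      = (\<integral>\<^sup>+y. ennreal (normal_density 0 \<sigma> y) * (ennreal (exp (\<theta> * y)) * indicator {b<..} y) \<partial>lborel)"
    by (subst nn_integral_density) auto
  also have "\<dots> \<le> (\<integral>\<^sup>+y. ennreal (exp (\<rho>\<^sup>2 * \<sigma>\<^sup>2 / 2 - \<eta> * b)) * ennreal (normal_density (\<rho> * \<sigma>\<^sup>2) \<sigma> y) \<partial>lborel)"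
  proof (rule nn_integral_mono)
    fix y :: real
    have "normal_density 0 \<sigma> y * exp (\<theta> * y) \<le> exp (\<rho>\<^sup>2 * \<sigma>\<^sup>2 / 2 - \<eta> * b) * normal_density (\<rho> * \<sigma>\<^sup>2) \<sigma> y"
      if "b < y"
    proof -
      have "\<eta> * b \<le> \<eta> * y" using that \<open>\<eta> \<ge> 0\<close> by (intro mult_left_mono) auto
      then have "exp (\<theta> * y) \<le> exp (\<rho> * y) * exp (- (\<eta> * b))"
        by (simp add: exp_add[symmetric] \<rho>_def algebra_simps)
      then have "normal_density 0 \<sigma> y * exp (\<theta> * y) \<le> normal_density 0 \<sigma> y * (exp (\<rho> * y) * exp (- (\<eta> * b)))"
        by (rule mult_left_mono) (simp add: normal_density_nonneg)
      also have "\<dots> = exp (\<rho>\<^sup>2 * \<sigma>\<^sup>2 / 2) * normal_density (\<rho> * \<sigma>\<^sup>2) \<sigma> y * exp (- (\<eta> * b))"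
        by (simp only: mult.assoc[symmetric] tilt)
      also have "\<dots> = (exp (\<rho>\<^sup>2 * \<sigma>\<^sup>2 / 2) * exp (- (\<eta> * b))) * normal_density (\<rho> * \<sigma>\<^sup>2) \<sigma> y"
        by (simp only: mult_ac)
      also have "exp (\<rho>\<^sup>2 * \<sigma>\<^sup>2 / 2) * exp (- (\<eta> * b)) = exp (\<rho>\<^sup>2 * \<sigma>\<^sup>2 / 2 - \<eta> * b)"
        by (simp add: exp_add[symmetric])
      finally show ?thesis .
    qed
    then show "ennreal (normal_density 0 \<sigma> y) * (ennreal (exp (\<theta> * y)) * indicator {b<..} y)
        \<le> ennreal (exp (\<rho>\<^sup>2 * \<sigma>\<^sup>2 / 2 - \<eta> * b)) * ennreal (normal_density (\<rho> * \<sigma>\<^sup>2) \<sigma> y)"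
      by (auto simp: indicator_def ennreal_mult'[symmetric] normal_density_nonneg intro!: ennreal_leI)
  qed
  also have "\<dots> = ennreal (exp (\<rho>\<^sup>2 * \<sigma>\<^sup>2 / 2 - \<eta> * b)) * (\<integral>\<^sup>+y. ennreal (normal_density (\<rho> * \<sigma>\<^sup>2) \<sigma> y) \<partial>lborel)"
    by (subst nn_integral_cmult) auto
  also have "(\<integral>\<^sup>+y. ennreal (normal_density (\<rho> * \<sigma>\<^sup>2) \<sigma> y) \<partial>lborel) = 1"
    using \<sigma> by (subst nn_integral_eq_integral) (auto simp: normal_density_nonneg)
  finally show ?thesis by (simp add: \<rho>_def)
qed

lemma (in prob_space) normal_chernoff_bound:
  assumes D: "distributed M lborel D (normal_density 0 \<sigma>)" and "\<sigma> > 0" "\<eta> \<ge> 0"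
  shows "prob {\<omega>\<in>space M. b < D \<omega>} \<le> exp (\<eta>\<^sup>2 * \<sigma>\<^sup>2 / 2 - \<eta> * b)"
proof -
  have "emeasure M {\<omega>\<in>space M. b < D \<omega>} = emeasure M (D -` {b<..} \<inter> space M)"
    by (rule arg_cong[where f = "emeasure M"]) auto
  also have "\<dots> = emeasure (distr M lborel D) {b<..}"
    using distributed_measurable[OF D] by (simp add: emeasure_distr)
  also have "\<dots> = (\<integral>\<^sup>+y. ennreal (exp (0 * y)) * indicator {b<..} y \<partial>density lborel (normal_density 0 \<sigma>))"
    by (simp add: distributed_distr_eq_density[OF D])
  also have "\<dots> \<le> ennreal (exp ((0 + \<eta>)\<^sup>2 * \<sigma>\<^sup>2 / 2 - \<eta> * b))"
    by (rule nn_integral_exp_normal_tail) fact+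
  finally show ?thesis by (simp add: emeasure_eq_measure)
qed

lemma (in prob_space) normal_prob_nonpos:
  assumes D: "distributed M lborel D (normal_density 0 \<sigma>)" and \<sigma>: "\<sigma> > 0"
  shows "1 / 2 \<le> prob {\<omega>\<in>space M. D \<omega> \<le> 0}"
proof -
  have D': "distributed M lborel (\<lambda>\<omega>. - D \<omega>) (normal_density 0 \<sigma>)"
    using normal_density_affine[OF D \<sigma>, of "-1" 0] by simp
  have [measurable]: "D \<in> borel_measurable M"
    using distributed_measurable[OF D] by simp
  have "prob {\<omega>\<in>space M. - D \<omega> \<le> 0} = measure (distr M lborel (\<lambda>\<omega>. - D \<omega>)) {..0}"
    by (subst measure_distr) (auto intro!: arg_cong[where f = prob])
  also have "\<dots> = measure (distr M lborel D) {..0}"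
    by (simp add: distributed_distr_eq_density[OF D] distributed_distr_eq_density[OF D'])
  also have "\<dots> = prob {\<omega>\<in>space M. D \<omega> \<le> 0}"
    by (subst measure_distr) (auto intro!: arg_cong[where f = prob])
  finally have eq: "prob {\<omega>\<in>space M. - D \<omega> \<le> 0} = prob {\<omega>\<in>space M. D \<omega> \<le> 0}" .
  have "1 = prob ({\<omega>\<in>space M. D \<omega> \<le> 0} \<union> {\<omega>\<in>space M. - D \<omega> \<le> 0})"
    unfolding prob_space[symmetric] by (rule arg_cong[where f = prob]) auto
  also have "\<dots> \<le> prob {\<omega>\<in>space M. D \<omega> \<le> 0} + prob {\<omega>\<in>space M. - D \<omega> \<le> 0}"
    by (rule measure_Un_le) measurable
  finally show ?thesis using eq by simp
qed

section \<open>The running minimum of Brownian motion\<close>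

text \<open>
  Levy's inequality. Decompose by the first index \<open>k\<close> at which the partial sum drops below \<open>- a\<close>. What
  remains of the sum is independent of this event and nonpositive with probability at least 1/2,
  and in that case the full sum lies below \<open>- a\<close> as well.
\<close>

lemma (in prob_space) levy_minimum_inequality:
  fixes Y :: "nat \<Rightarrow> 'a \<Rightarrow> real"
  assumes ind: "indep_vars (\<lambda>_. borel) Y {..<n}"
    and half: "\<And>k. k \<le> n \<Longrightarrow> 1 / 2 \<le> prob {\<omega>\<in>space M. (\<Sum>j\<in>{k..<n}. Y j \<omega>) \<le> 0}"
  shows "prob {\<omega>\<in>space M. \<exists>k\<le>n. (\<Sum>j<k. Y j \<omega>) < - a} \<le> 2 * prob {\<omega>\<in>space M. (\<Sum>j<n. Y j \<omega>) < - a}"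
proof -
  have Y_meas: "Y j \<in> borel_measurable M" if "j < n" for j
    using ind that by (auto simp: indep_vars_def)
  define S where "S k \<omega> = (\<Sum>j<k. Y j \<omega>)" for k \<omega>
  have S_meas: "S k \<in> borel_measurable M" if "k \<le> n" for k
    unfolding S_def using that by (intro borel_measurable_sum Y_meas) auto
  define A where "A k = {\<omega>\<in>space M. S k \<omega> < - a \<and> (\<forall>i\<in>{..<k}. - a \<le> S i \<omega>)}" for k
  define T where "T k = {\<omega>\<in>space M. (\<Sum>j\<in>{k..<n}. Y j \<omega>) \<le> 0}" for k
  have R_meas: "(\<lambda>\<omega>. \<Sum>j\<in>{k..<n}. Y j \<omega>) \<in> borel_measurable M" for k
    by (intro borel_measurable_sum Y_meas) auto
  have T_meas: "T k \<in> events" for k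
    unfolding T_def using R_meas[of k] by measurable
  have A_meas: "A k \<in> events" if "k \<le> n" for k
  proof -
    note S_meas[measurable]
    have [measurable]: "Measurable.pred M (\<lambda>\<omega>. \<forall>i\<in>{..<k}. - a \<le> S i \<omega>)"
      by (rule pred_intros_finite) (use that S_meas in \<open>auto intro!: borel_measurable_le\<close>)
    show ?thesis unfolding A_def using S_meas[OF that] by measurable
  qed
  have indep_AT: "prob (A k \<inter> T k) = prob (A k) * prob (T k)" if "k \<le> n" for k
  proof -
    let ?P = "PiM {..<k} (\<lambda>_. borel :: real measure)" and ?Q = "PiM {k..<n} (\<lambda>_. borel :: real measure)"
    have iv: "indep_var ?P (\<lambda>\<omega>. restrict (\<lambda>i. Y i \<omega>) {..<k}) ?Q (\<lambda>\<omega>. restrict (\<lambda>i. Y i \<omega>) {k..<n})"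
      by (rule indep_var_restrict[OF ind]) (use that in auto)
    have m: "(\<lambda>f. \<Sum>j<i. f j) \<in> borel_measurable ?P" if "i \<le> k" for i
      using that by (intro borel_measurable_sum measurable_component_singleton) auto
    have [measurable]: "Measurable.pred ?P (\<lambda>f. \<forall>i\<in>{..<k}. - a \<le> (\<Sum>j<i. f j))"
      by (rule pred_intros_finite) (use m in \<open>auto intro!: borel_measurable_le\<close>)
    have Xa: "{f\<in>space ?P. (\<Sum>j<k. f j) < - a \<and> (\<forall>i\<in>{..<k}. - a \<le> (\<Sum>j<i. f j))} \<in> sets ?P" (is "?Xa \<in> _")
      using m[of k] by measurable
    have m2: "(\<lambda>f. \<Sum>j\<in>{k..<n}. f j) \<in> borel_measurable ?Q"
      by (intro borel_measurable_sum measurable_component_singleton) auto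
    have Xb: "{f\<in>space ?Q. (\<Sum>j\<in>{k..<n}. f j) \<le> 0} \<in> sets ?Q" (is "?Xb \<in> _")
      using m2 by measurable
    have restr: "(\<Sum>j<i. restrict (\<lambda>i. Y i \<omega>) {..<k} j) = S i \<omega>" if "i \<le> k" for i \<omega>
      unfolding S_def using that by (intro sum.cong) auto
    have 1: "(\<lambda>\<omega>. restrict (\<lambda>i. Y i \<omega>) {..<k}) -` ?Xa \<inter> space M = A k"
      using restr by (auto simp: A_def space_PiM)
    have 2: "(\<lambda>\<omega>. restrict (\<lambda>i. Y i \<omega>) {k..<n}) -` ?Xb \<inter> space M = T k"
      by (auto simp: T_def space_PiM)
    have "(\<lambda>\<omega>. (restrict (\<lambda>i. Y i \<omega>) {..<k}, restrict (\<lambda>i. Y i \<omega>) {k..<n})) -` (?Xa \<times> ?Xb) \<inter> space M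
        = A k \<inter> T k"
      unfolding 1[symmetric] 2[symmetric] by auto
    with indep_varD[OF iv Xa Xb] 1 2 show ?thesis by simp
  qed
  have disj: "disjoint_family_on A {..n}"
  proof -
    have "A i \<inter> A j = {}" if "i < j" for i j
    proof (rule equals0I)
      fix \<omega> assume "\<omega> \<in> A i \<inter> A j"
      then have "S i \<omega> < - a" "\<forall>i\<in>{..<j}. - a \<le> S i \<omega>" by (auto simp: A_def)
      with that show False by (meson lessThan_iff not_le)
    qed
    then show ?thesis unfolding disjoint_family_on_def by (metis Int_commute linorder_neqE_nat)
  qed
  have "{\<omega>\<in>space M. \<exists>k\<le>n. S k \<omega> < - a} = (\<Union>k\<le>n. A k)"
  proof (intro set_eqI iffI)
    fix \<omega> assume "\<omega> \<in> {\<omega>\<in>space M. \<exists>k\<le>n. S k \<omega> < - a}"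
    then obtain k where \<omega>: "\<omega> \<in> space M" and k: "k \<le> n" "S k \<omega> < - a" by auto
    define l where "l = (LEAST l. S l \<omega> < - a)"
    have "S l \<omega> < - a" "l \<le> k" using k unfolding l_def by (auto intro: LeastI Least_le)
    moreover have "- a \<le> S i \<omega>" if "i < l" for i
      using not_less_Least[OF that[unfolded l_def]] by simp
    ultimately show "\<omega> \<in> (\<Union>k\<le>n. A k)" using \<omega> k by (auto simp: A_def intro!: bexI[of _ l])
  qed (auto simp: A_def)
  then have "prob {\<omega>\<in>space M. \<exists>k\<le>n. S k \<omega> < - a} = (\<Sum>k\<le>n. prob (A k))"
    using finite_measure_finite_Union[OF _ _ disj] A_meas by auto
  also have "\<dots> \<le> (\<Sum>k\<le>n. 2 * prob (A k \<inter> T k))"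
  proof (rule sum_mono)
    fix k assume "k \<in> {..n}"
    then have "prob (A k) * (1 / 2) \<le> prob (A k) * prob (T k)"
      using half[of k] by (intro mult_left_mono) (auto simp: T_def)
    then show "prob (A k) \<le> 2 * prob (A k \<inter> T k)" using indep_AT[of k] \<open>k \<in> {..n}\<close> by simp
  qed
  also have "\<dots> = 2 * prob (\<Union>k\<le>n. A k \<inter> T k)"
  proof -
    have "disjoint_family_on (\<lambda>k. A k \<inter> T k) {..n}"
      using disj by (auto simp: disjoint_family_on_def)
    from finite_measure_finite_Union[OF _ _ this] A_meas T_meas
    have "prob (\<Union>k\<le>n. A k \<inter> T k) = (\<Sum>k\<le>n. prob (A k \<inter> T k))" by auto
    then show ?thesis by (simp add: sum_distrib_left)
  qed
  also have "prob (\<Union>k\<le>n. A k \<inter> T k) \<le> prob {\<omega>\<in>space M. S n \<omega> < - a}"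
  proof (rule finite_measure_mono)
    show "{\<omega>\<in>space M. S n \<omega> < - a} \<in> events" using S_meas[of n] by measurable
    show "(\<Union>k\<le>n. A k \<inter> T k) \<subseteq> {\<omega>\<in>space M. S n \<omega> < - a}"
    proof safe
      fix k \<omega> assume k: "k \<le> n" and "\<omega> \<in> A k" "\<omega> \<in> T k"
      have "S n \<omega> = S k \<omega> + (\<Sum>j\<in>{k..<n}. Y j \<omega>)"
        unfolding S_def using sum.atLeastLessThan_concat[of 0 k n "\<lambda>j. Y j \<omega>"] k
        by (simp add: atLeast0LessThan)
      with \<open>\<omega> \<in> A k\<close> \<open>\<omega> \<in> T k\<close> show "S n \<omega> < - a" "\<omega> \<in> space M" by (auto simp: A_def T_def)
    qed
  qed
  finally show ?thesis by (simp add: S_def)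
qed

context brownian_motion
begin

lemma distr_B:
  assumes "t > 0"
  shows "distr M borel (B t) = density lborel (normal_density 0 (sqrt t))"
proof -
  have "distr M borel (B t) = distr M lborel (\<lambda>\<omega>. B t \<omega> - B 0 \<omega>)"
    using start_B random_variable_B[of t] random_variable_B[of 0] assms
    by (intro distr_cong_AE) auto
  then show ?thesis
    using distributed_distr_eq_density[OF increment_B[of 0 t]] assms by simp
qed

lemma distributed_B:
  assumes "t > 0"
  shows "distributed M lborel (B t) (normal_density 0 (sqrt t))"
proof -
  have "distr M lborel (B t) = distr M borel (B t)" by (rule distr_cong) auto
  then show ?thesis
    using distr_B[OF assms] random_variable_B[of t] assms by (simp add: distributed_def)
qed

text \<open>
  Levy's inequality for the increments between consecutive points. The times \<open>0\<close> and \<open>t\<close> are added to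
  the set, so that the partial sums are the values of the path and the full sum is \<open>B t\<close>, almost surely.
\<close>

lemma minimum_over_finite_set:
  assumes J: "finite J" "J \<subseteq> {0..t}" and t: "t > 0"
  shows "prob {\<omega>\<in>space M. \<exists>s\<in>J. B s \<omega> < - a} \<le> 2 * prob {\<omega>\<in>space M. B t \<omega> < - a}"
proof -
  define J' where "J' = insert 0 (insert t J)"
  have J': "finite J'" "J \<subseteq> J'" "J' \<subseteq> {0..t}" "0 \<in> J'" "t \<in> J'" "J' \<noteq> {}"
    using J t by (auto simp: J'_def)
  define l where "l = sorted_list_of_set J'"
  define u where "u = (\<lambda>i. l ! i)"
  define n where "n = length l - 1"
  have l: "sorted_wrt (<) l" "set l = J'" "length l = Suc n"
    using J' by (auto simp: l_def n_def card_gt_0_iff Suc_diff_1)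
  have u_in: "u i \<in> {0..t}" if "i \<le> n" for i
    using J' l that nth_mem[of i l] by (auto simp: u_def)
  have u_less: "u i < u j" if "i < j" "j \<le> n" for i j
    using sorted_wrt_nth_less[OF l(1) that(1)] that l by (simp add: u_def)
  have u_surj: "\<exists>i\<le>n. u i = s" if "s \<in> J'" for s
    using that l(2,3) unfolding u_def by (metis in_set_conv_nth less_Suc_eq_le)
  have u0: "u 0 = 0"
    using u_surj[of 0] J' u_less[of 0] u_in[of 0] by (metis atLeastAtMost_iff le0 linorder_not_less neq0_conv)
  have un: "u n = t"
    using u_surj[of t] J' u_less[of _ n] u_in[of n]
    by (metis atLeastAtMost_iff le_refl linorder_not_less order_le_less)
  have B_meas: "B (u k) \<in> borel_measurable M" if "k \<le> n" for k
    using u_in[OF that] by (intro random_variable_B) auto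
  have B_meas': "B s \<in> borel_measurable M" if "s \<in> J'" for s
    using J' that by (intro random_variable_B) auto
  define Y where "Y = (\<lambda>i \<omega>. B (u (Suc i)) \<omega> - B (u i) \<omega>)"
  have ind: "indep_vars (\<lambda>_. borel) Y {..<n}"
    unfolding Y_def by (rule indep_increments_B) (use u0 u_less in auto)
  have tele: "(\<Sum>j\<in>{k..<m}. Y j \<omega>) = B (u m) \<omega> - B (u k) \<omega>" if "k \<le> m" for k m \<omega>
    unfolding Y_def using that by (rule sum_Suc_diff')
  have tele0: "(\<Sum>j<k. Y j \<omega>) = B (u k) \<omega> - B 0 \<omega>" for k \<omega>
    using tele[of 0 k] u0 by (simp add: atLeast0LessThan)
  have half: "1 / 2 \<le> prob {\<omega>\<in>space M. (\<Sum>j\<in>{k..<n}. Y j \<omega>) \<le> 0}" if "k \<le> n" for k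
  proof (cases "k = n")
    case True
    then show ?thesis by (simp add: prob_space)
  next
    case False
    with that have "k < n" by simp
    have "distributed M lborel (\<lambda>\<omega>. B (u n) \<omega> - B (u k) \<omega>) (normal_density 0 (sqrt (u n - u k)))"
      using u_less[OF \<open>k < n\<close>] u_in[OF that] by (intro increment_B) auto
    from normal_prob_nonpos[OF this] u_less[OF \<open>k < n\<close>] show ?thesis
      by (simp only: tele[OF that]) simp
  qed
  have "prob {\<omega>\<in>space M. \<exists>s\<in>J. B s \<omega> < - a}
      \<le> prob {\<omega>\<in>space M. \<exists>k\<le>n. (\<Sum>j<k. Y j \<omega>) < - a}"
  proof (rule finite_measure_mono_AE)
    show "AE \<omega> in M. \<omega> \<in> {\<omega>\<in>space M. \<exists>s\<in>J. B s \<omega> < - a} \<longrightarrow>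
        \<omega> \<in> {\<omega>\<in>space M. \<exists>k\<le>n. (\<Sum>j<k. Y j \<omega>) < - a}"
      using start_B
    proof eventually_elim
      case (elim \<omega>)
      then show ?case using u_surj J'(2) by (fastforce simp: tele0)
    qed
    have eq: "{\<omega>\<in>space M. \<exists>k\<le>n. (\<Sum>j<k. Y j \<omega>) < - a} = (\<Union>k\<le>n. {\<omega>\<in>space M. B (u k) \<omega> - B 0 \<omega> < - a})"
      by (auto simp: tele0)
    show "{\<omega>\<in>space M. \<exists>k\<le>n. (\<Sum>j<k. Y j \<omega>) < - a} \<in> events"
      unfolding eq
    proof (rule sets.finite_UN)
      fix k assume "k \<in> {..n}"
      then show "{\<omega>\<in>space M. B (u k) \<omega> - B 0 \<omega> < - a} \<in> events"
        using B_meas[of k] random_variable_B[of 0] by simp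
    qed simp
  qed
  also have "\<dots> \<le> 2 * prob {\<omega>\<in>space M. (\<Sum>j<n. Y j \<omega>) < - a}"
    using ind half by (rule levy_minimum_inequality)
  also have "prob {\<omega>\<in>space M. (\<Sum>j<n. Y j \<omega>) < - a} = prob {\<omega>\<in>space M. B t \<omega> < - a}"
  proof (rule finite_measure_eq_AE)
    show "AE \<omega> in M. (\<omega> \<in> {\<omega>\<in>space M. (\<Sum>j<n. Y j \<omega>) < - a}) = (\<omega> \<in> {\<omega>\<in>space M. B t \<omega> < - a})"
      using start_B by eventually_elim (simp add: tele0 un)
    have "B t \<in> borel_measurable M" "B 0 \<in> borel_measurable M" using t by (auto intro: random_variable_B)
    then show "{\<omega>\<in>space M. (\<Sum>j<n. Y j \<omega>) < - a} \<in> events" "{\<omega>\<in>space M. B t \<omega> < - a} \<in> events"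
      by (simp_all add: tele0 un)
  qed
  finally show ?thesis by simp
qed

text \<open>
  The finite bound is uniform, so it passes to the increasing limit over an enumeration of the
  rationals. The tail of \<open>B t\<close> is estimated with the Chernoff parameter \<open>1 / sqrt t\<close>, which is adapted
  to levels \<open>a\<close> much larger than \<open>sqrt t\<close>.
\<close>

lemma minimum_over_rationals:
  assumes t: "t > 0"
  shows "{\<omega>\<in>space M. \<forall>q\<in>\<rat> \<inter> {0..t}. - a \<le> B q \<omega>} \<in> events"
    and "1 - 2 * exp (1 / 2 - a / sqrt t) \<le> prob {\<omega>\<in>space M. \<forall>q\<in>\<rat> \<inter> {0..t}. - a \<le> B q \<omega>}"
proof -
  let ?Q = "\<rat> \<inter> {0..t}"
  have Q: "countable ?Q" "?Q \<noteq> {}" using t countable_rat by auto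
  define r where "r = from_nat_into ?Q"
  have r: "range r = ?Q" unfolding r_def using Q by (rule range_from_nat_into[rotated])
  have r_in: "r i \<in> {0..t}" for i using r by auto
  define E where "E m = {\<omega>\<in>space M. \<exists>s\<in>r ` {..m}. B s \<omega> < - a}" for m
  have E_meas: "E m \<in> events" for m
  proof -
    have "E m = (\<Union>i\<le>m. {\<omega>\<in>space M. B (r i) \<omega> < - a})" by (auto simp: E_def)
    moreover have "{\<omega>\<in>space M. B (r i) \<omega> < - a} \<in> events" for i
      using random_variable_B[of "r i"] r_in[of i] by simp
    ultimately show ?thesis by auto
  qed
  have inc: "incseq E" by (auto simp: incseq_def E_def)
  have bad: "space M - {\<omega>\<in>space M. \<forall>q\<in>?Q. - a \<le> B q \<omega>} = (\<Union>m. E m)"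
  proof (intro set_eqI iffI)
    fix \<omega> assume "\<omega> \<in> space M - {\<omega>\<in>space M. \<forall>q\<in>?Q. - a \<le> B q \<omega>}"
    then obtain i where "\<omega> \<in> space M" "B (r i) \<omega> < - a" unfolding r[symmetric] by (auto simp: not_le)
    then show "\<omega> \<in> (\<Union>m. E m)" by (auto simp: E_def intro!: exI[of _ i])
  next
    fix \<omega> assume "\<omega> \<in> (\<Union>m. E m)"
    then obtain i where "\<omega> \<in> space M" "B (r i) \<omega> < - a" by (auto simp: E_def)
    moreover have "r i \<in> ?Q" using r by blast
    ultimately have "\<omega> \<in> space M" "\<not> (\<forall>q\<in>?Q. - a \<le> B q \<omega>)" by (simp, meson not_le)
    then show "\<omega> \<in> space M - {\<omega>\<in>space M. \<forall>q\<in>?Q. - a \<le> B q \<omega>}" by blast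
  qed
  have "{\<omega>\<in>space M. \<forall>q\<in>?Q. - a \<le> B q \<omega>} = space M - (\<Union>m. E m)"
    unfolding bad[symmetric] by auto
  then show meas: "{\<omega>\<in>space M. \<forall>q\<in>?Q. - a \<le> B q \<omega>} \<in> events" using E_meas by auto
  have D': "distributed M lborel (\<lambda>\<omega>. - B t \<omega>) (normal_density 0 (sqrt t))"
    using normal_density_affine[OF distributed_B[OF t], of "-1" 0] t by simp
  have "prob {\<omega>\<in>space M. a < - B t \<omega>} \<le> exp ((1 / sqrt t)\<^sup>2 * (sqrt t)\<^sup>2 / 2 - (1 / sqrt t) * a)"
    by (rule normal_chernoff_bound[OF D']) (use t in auto)
  also have "\<dots> = exp (1 / 2 - a / sqrt t)" using t by (simp add: power_divide)
  finally have tail: "prob {\<omega>\<in>space M. B t \<omega> < - a} \<le> exp (1 / 2 - a / sqrt t)"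
    by (simp add: less_minus_iff)
  have "prob (E m) \<le> 2 * exp (1 / 2 - a / sqrt t)" for m
    using minimum_over_finite_set[of "r ` {..m}" t a] r_in t tail by (fastforce simp: E_def)
  moreover have "(\<lambda>m. prob (E m)) \<longlonglongrightarrow> prob (\<Union>m. E m)"
    using E_meas inc by (intro finite_Lim_measure_incseq) auto
  ultimately have "prob (\<Union>m. E m) \<le> 2 * exp (1 / 2 - a / sqrt t)"
    by (intro LIMSEQ_le_const2) auto
  then show "1 - 2 * exp (1 / 2 - a / sqrt t) \<le> prob {\<omega>\<in>space M. \<forall>q\<in>?Q. - a \<le> B q \<omega>}"
    unfolding bad[symmetric] using prob_compl[OF meas] by simp
qed

end

section \<open>Hitting times of continuous paths\<close>

text \<open>
  A continuous path that is nonzero at \<open>t\<close> stays so for a while after \<open>t\<close>, so the zeros of a path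
  without zeros in \<open>{0..t}\<close> keep a positive distance from \<open>t\<close>, and the inequality is strict.
\<close>

lemma hitting_time_0_gt_iff:
  assumes cont: "continuous_on {0..} (\<lambda>s. Y s \<omega>)" and "0 \<le> t"
  shows "ereal t < hitting_time_0 Y \<omega> \<longleftrightarrow> (\<forall>s\<in>{0..t}. Y s \<omega> \<noteq> 0)"
proof
  assume *: "ereal t < hitting_time_0 Y \<omega>"
  show "\<forall>s\<in>{0..t}. Y s \<omega> \<noteq> 0"
  proof (intro ballI notI)
    fix s assume s: "s \<in> {0..t}" "Y s \<omega> = 0"
    then have "hitting_time_0 Y \<omega> \<le> ereal s"
      unfolding hitting_time_0_def by (intro Inf_lower) auto
    also have "\<dots> \<le> ereal t" using s by simp
    finally show False using * by simp
  qed
next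
  assume *: "\<forall>s\<in>{0..t}. Y s \<omega> \<noteq> 0"
  then have "\<bar>Y t \<omega>\<bar> > 0" using \<open>0 \<le> t\<close> by simp
  then obtain d where d: "d > 0" "\<And>s. 0 \<le> s \<Longrightarrow> dist s t < d \<Longrightarrow> dist (Y s \<omega>) (Y t \<omega>) < \<bar>Y t \<omega>\<bar>"
    using cont \<open>0 \<le> t\<close> unfolding continuous_on_iff by (metis atLeast_iff)
  have "ereal (t + d) \<le> hitting_time_0 Y \<omega>"
    unfolding hitting_time_0_def
  proof (rule Inf_greatest)
    fix e assume "e \<in> {ereal s | s. 0 \<le> s \<and> Y s \<omega> = 0}"
    then obtain s where s: "e = ereal s" "0 \<le> s" "Y s \<omega> = 0" by blast
    with * have "t < s" by force
    moreover have "\<not> dist s t < d" using d(2)[OF s(2)] s(3) by (auto simp: dist_real_def)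
    ultimately show "ereal (t + d) \<le> e" using s(1) by (simp add: dist_real_def)
  qed
  moreover have "ereal t < ereal (t + d)" using d(1) by simp
  ultimately show "ereal t < hitting_time_0 Y \<omega>" by (rule less_le_trans[rotated])
qed

lemma ball_atLeastAtMost_iff_rationals:
  fixes f :: "real \<Rightarrow> real"
  assumes cont: "continuous_on {0..t} f" and "0 < t"
  shows "(\<forall>s\<in>{0..t}. c \<le> f s) \<longleftrightarrow> (\<forall>q\<in>\<rat> \<inter> {0..t}. c \<le> f q)"
proof
  assume *: "\<forall>q\<in>\<rat> \<inter> {0..t}. c \<le> f q"
  have "{0<..<t} \<subseteq> closure ({0<..<t} \<inter> \<rat>)"
    using open_Int_closure_subset[of "{0<..<t}" "\<rat>"] by (simp add: Rats_closure_real)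
  then have "closure {0<..<t} \<subseteq> closure ({0<..<t} \<inter> \<rat>)" by (rule closure_minimal) simp
  moreover have "closure ({0<..<t} \<inter> \<rat>) \<subseteq> {0..t}" by (rule closure_minimal) auto
  ultimately have cl: "closure ({0<..<t} \<inter> \<rat>) = {0..t}" using \<open>0 < t\<close> by simp
  show "\<forall>s\<in>{0..t}. c \<le> f s"
  proof
    fix s assume "s \<in> {0..t}"
    show "c \<le> f s"
      by (rule continuous_ge_on_closure[of "{0<..<t} \<inter> \<rat>" f]) (use cl cont * \<open>s \<in> {0..t}\<close> in auto)
  qed
qed auto

text \<open>
  A continuous path without zeros on the compact interval \<open>{0..t}\<close> is bounded away from \<open>0\<close> there.
  This expresses survival by countably many times and makes it an event.
\<close>

lemma hitting_time_0_gt_iff_rationals: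
  assumes cont: "continuous_on {0..} (\<lambda>s. Y s \<omega>)" and "0 < t"
  shows "ereal t < hitting_time_0 Y \<omega> \<longleftrightarrow> (\<exists>n. \<forall>q\<in>\<rat> \<inter> {0..t}. inverse (Suc n) \<le> \<bar>Y q \<omega>\<bar>)"
proof -
  have cont': "continuous_on {0..t} (\<lambda>s. \<bar>Y s \<omega>\<bar>)"
    by (intro continuous_intros continuous_on_subset[OF cont]) auto
  have "(\<forall>s\<in>{0..t}. Y s \<omega> \<noteq> 0) \<longleftrightarrow> (\<exists>n. \<forall>s\<in>{0..t}. inverse (Suc n) \<le> \<bar>Y s \<omega>\<bar>)"
  proof
    assume nz: "\<forall>s\<in>{0..t}. Y s \<omega> \<noteq> 0"
    obtain z where z: "z \<in> {0..t}" "\<forall>s\<in>{0..t}. \<bar>Y z \<omega>\<bar> \<le> \<bar>Y s \<omega>\<bar>"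
      using continuous_attains_inf[OF _ _ cont'] \<open>0 < t\<close> by auto
    with nz obtain n where "inverse (real (Suc n)) < \<bar>Y z \<omega>\<bar>"
      using reals_Archimedean[of "\<bar>Y z \<omega>\<bar>"] by auto
    with z show "\<exists>n. \<forall>s\<in>{0..t}. inverse (Suc n) \<le> \<bar>Y s \<omega>\<bar>" by (meson less_imp_le less_le_trans)
  next
    assume "\<exists>n. \<forall>s\<in>{0..t}. inverse (Suc n) \<le> \<bar>Y s \<omega>\<bar>"
    then obtain n where "\<forall>s\<in>{0..t}. inverse (Suc n) \<le> \<bar>Y s \<omega>\<bar>" by blast
    moreover have "0 < inverse (real (Suc n))" by simp
    ultimately show "\<forall>s\<in>{0..t}. Y s \<omega> \<noteq> 0" by (metis abs_zero not_le)
  qed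
  with hitting_time_0_gt_iff[of Y \<omega> t] cont \<open>0 < t\<close>
    ball_atLeastAtMost_iff_rationals[OF cont' \<open>0 < t\<close>] show ?thesis by simp
qed

section \<open>Brownian motion with negative drift and an independent start\<close>

lemma (in prob_space) emeasure_indep_var_slices:
  assumes ind: "indep_var S Y T X" and A: "A \<in> sets (S \<Otimes>\<^sub>M T)"
  shows "emeasure M {\<omega>\<in>space M. (Y \<omega>, X \<omega>) \<in> A}
    = (\<integral>\<^sup>+y. emeasure M {\<omega>\<in>space M. (y, X \<omega>) \<in> A} \<partial>distr M S Y)"
proof -
  have rv: "Y \<in> measurable M S" "X \<in> measurable M T"
    and eq: "distr M S Y \<Otimes>\<^sub>M distr M T X = distr M (S \<Otimes>\<^sub>M T) (\<lambda>\<omega>. (Y \<omega>, X \<omega>))"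
    using ind by (auto simp: indep_var_distribution_eq)
  interpret X: prob_space "distr M T X" by (rule prob_space_distr) fact
  have "emeasure M {\<omega>\<in>space M. (Y \<omega>, X \<omega>) \<in> A} = emeasure M ((\<lambda>\<omega>. (Y \<omega>, X \<omega>)) -` A \<inter> space M)"
    by (rule arg_cong[where f = "emeasure M"]) auto
  also have "\<dots> = emeasure (distr M (S \<Otimes>\<^sub>M T) (\<lambda>\<omega>. (Y \<omega>, X \<omega>))) A"
    using rv A by (subst emeasure_distr) auto
  also have "\<dots> = (\<integral>\<^sup>+y. emeasure (distr M T X) (Pair y -` A) \<partial>distr M S Y)"
    unfolding eq[symmetric] using A by (intro X.emeasure_pair_measure_alt) simp
  also have "\<dots> = (\<integral>\<^sup>+y. emeasure M {\<omega>\<in>space M. (y, X \<omega>) \<in> A} \<partial>distr M S Y)"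
  proof (rule nn_integral_cong)
    fix y
    have "Pair y -` A \<in> sets T" using A by (rule sets_Pair1)
    then have "emeasure (distr M T X) (Pair y -` A) = emeasure M (X -` (Pair y -` A) \<inter> space M)"
      using rv by (simp add: emeasure_distr)
    also have "X -` (Pair y -` A) \<inter> space M = {\<omega>\<in>space M. (y, X \<omega>) \<in> A}" by auto
    finally show "emeasure (distr M T X) (Pair y -` A) = emeasure M {\<omega>\<in>space M. (y, X \<omega>) \<in> A}" .
  qed
  finally show ?thesis .
qed

locale drifted_brownian_motion = brownian_motion M B
  for M :: "'a measure" and B :: "real \<Rightarrow> 'a \<Rightarrow> real" +
  fixes X0 :: "'a \<Rightarrow> real" and \<alpha> :: real
  assumes random_variable_X0: "X0 \<in> borel_measurable M"
    and indep_X0_B: "indep_set (sets (vimage_algebra (space M) X0 borel))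
      (sets (vimage_algebra (space M) (\<lambda>\<omega>. \<lambda>t\<in>{0..}. B t \<omega>) (\<Pi>\<^sub>M t\<in>{0..}. borel)))"
    and X0_nonneg: "AE \<omega> in M. 0 \<le> X0 \<omega>"
    and drift_pos: "\<alpha> > 0"
begin

abbreviation X where "X \<equiv> drifted \<alpha> X0 B"
abbreviation \<tau> where "\<tau> \<equiv> hitting_time_0 X"

text \<open>
  Independence is assumed for the sigma-algebra of the whole path. An event that depends on
  countably many times is the preimage of a measurable set of functions.
\<close>

lemma indep_X0_path:
  assumes "A \<in> sets borel" "E \<in> sets (\<Pi>\<^sub>M t\<in>{0..}. borel)"
  shows "prob ((X0 -` A \<inter> space M) \<inter> ((\<lambda>\<omega>. \<lambda>t\<in>{0..}. B t \<omega>) -` E \<inter> space M))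
    = prob (X0 -` A \<inter> space M) * prob ((\<lambda>\<omega>. \<lambda>t\<in>{0..}. B t \<omega>) -` E \<inter> space M)"
  using assms by (intro indep_setD[OF indep_X0_B] in_vimage_algebra)

lemma indep_var_B_X0:
  assumes "0 \<le> t"
  shows "indep_var borel (B t) borel X0"
  unfolding indep_var_eq
proof (intro conjI)
  show rv: "B t \<in> borel_measurable M" "X0 \<in> borel_measurable M"
    using random_variable_B[OF assms] random_variable_X0 by auto
  show "indep_set (sigma_sets (space M) {B t -` A \<inter> space M |A. A \<in> sets borel})
          (sigma_sets (space M) {X0 -` A \<inter> space M |A. A \<in> sets borel})"
    unfolding sets_vimage_algebra[symmetric]
  proof (rule indep_setI)
    show "sets (vimage_algebra (space M) (B t) borel) \<subseteq> events"
         "sets (vimage_algebra (space M) X0 borel) \<subseteq> events"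
      using rv by (simp_all add: sets_image_in_sets)
    fix b a assume "b \<in> sets (vimage_algebra (space M) (B t) borel)"
      "a \<in> sets (vimage_algebra (space M) X0 borel)"
    then obtain S T where a: "a = X0 -` S \<inter> space M" "S \<in> sets borel"
      and b: "b = B t -` T \<inter> space M" "T \<in> sets borel"
      by (auto simp: sets_vimage_algebra2)
    let ?E = "(\<lambda>f. f t) -` T \<inter> space (\<Pi>\<^sub>M t\<in>{0..}. borel)"
    have "?E \<in> sets (\<Pi>\<^sub>M t\<in>{0..}. borel)"
      using assms b by (intro measurable_sets[of _ _ borel] measurable_component_singleton) auto
    from indep_X0_path[OF a(2) this]
    have "prob (a \<inter> b) = prob a * prob b"
      using assms by (simp add: a b space_PiM vimage_def Int_def restrict_PiE_iff conj_ac)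
    then show "prob (b \<inter> a) = prob b * prob a" by (simp add: Int_commute mult.commute)
  qed
qed

lemma random_variable_X: "0 \<le> t \<Longrightarrow> X t \<in> borel_measurable M"
  using random_variable_B[of t] random_variable_X0 unfolding drifted_def by measurable

lemma continuous_X: "\<omega> \<in> space M \<Longrightarrow> continuous_on {0..} (\<lambda>t. X t \<omega>)"
  unfolding drifted_def by (intro continuous_intros continuous_B)

lemma measurable_survival:
  assumes "0 < t"
  shows "{\<omega>\<in>space M. ereal t < \<tau> \<omega>} \<in> events"
proof -
  have "{\<omega>\<in>space M. ereal t < \<tau> \<omega>}
      = (\<Union>n. {\<omega>\<in>space M. \<forall>q\<in>\<rat> \<inter> {0..t}. inverse (Suc n) \<le> \<bar>X q \<omega>\<bar>})"
  proof -
    have "ereal t < \<tau> \<omega> \<longleftrightarrow> (\<exists>n. \<forall>q\<in>\<rat> \<inter> {0..t}. inverse (Suc n) \<le> \<bar>X q \<omega>\<bar>)" if "\<omega> \<in> space M" for \<omega>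
      using continuous_X[OF that] assms by (rule hitting_time_0_gt_iff_rationals)
    then show ?thesis by (simp add: set_eq_iff) blast
  qed
  moreover have "{\<omega>\<in>space M. \<forall>q\<in>\<rat> \<inter> {0..t}. inverse (Suc n) \<le> \<bar>X q \<omega>\<bar>} \<in> events" for n
  proof (rule sets.sets_Collect_countable_All')
    show "countable (\<rat> \<inter> {0..t})" using countable_rat by auto
    fix q assume "q \<in> \<rat> \<inter> {0..t}"
    then show "{\<omega>\<in>space M. inverse (Suc n) \<le> \<bar>X q \<omega>\<bar>} \<in> events"
      using random_variable_X[of q] by simp
  qed
  ultimately show ?thesis by auto
qed

text \<open>
  Almost every path starts at a nonnegative point, and if it has no zero up to time \<open>t\<close>, it is still
  positive at time \<open>t\<close> by the intermediate value theorem. Denominator and numerator of the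
  conditional probability thus have the same form.
\<close>

lemma survival_prob_eq:
  assumes "0 < t"
  shows "prob {\<omega>\<in>space M. ereal t < \<tau> \<omega>} = prob {\<omega>\<in>space M. 0 < X t \<omega> \<and> ereal t < \<tau> \<omega>}"
proof (rule finite_measure_eq_AE)
  show "AE \<omega> in M. (\<omega> \<in> {\<omega>\<in>space M. ereal t < \<tau> \<omega>}) = (\<omega> \<in> {\<omega>\<in>space M. 0 < X t \<omega> \<and> ereal t < \<tau> \<omega>})"
    using start_B X0_nonneg AE_space
  proof eventually_elim
    case (elim \<omega>)
    have "0 < X t \<omega>" if "ereal t < \<tau> \<omega>"
    proof (rule ccontr)
      assume "\<not> 0 < X t \<omega>"
      moreover have "0 \<le> X 0 \<omega>" using elim by (simp add: drifted_def)
      moreover have "continuous_on {0..t} (\<lambda>s. X s \<omega>)"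
        by (rule continuous_on_subset[OF continuous_X[OF elim(3)]]) auto
      ultimately obtain s where "0 \<le> s" "s \<le> t" "X s \<omega> = 0"
        using IVT2'[of "\<lambda>s. X s \<omega>" t 0 0] assms by auto
      with that show False
        using hitting_time_0_gt_iff[of X \<omega> t] continuous_X[OF elim(3)] assms by auto
    qed
    then show ?case by auto
  qed
  have "{\<omega>\<in>space M. 0 < X t \<omega> \<and> ereal t < \<tau> \<omega>}
      = {\<omega>\<in>space M. 0 < X t \<omega>} \<inter> {\<omega>\<in>space M. ereal t < \<tau> \<omega>}" by auto
  then show "{\<omega>\<in>space M. 0 < X t \<omega> \<and> ereal t < \<tau> \<omega>} \<in> events"
    using measurable_survival[OF assms] random_variable_X[of t] assms by simp
qed (rule measurable_survival[OF assms])

text \<open>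
  If the start is at least \<open>\<alpha> * t + v + 2 * b\<close> and \<open>B\<close> stays at or above \<open>- b\<close>, the path is at least
  \<open>v + b\<close> up to time \<open>t\<close>: the drift has removed at most \<open>\<alpha> * t\<close> and the noise at most \<open>b\<close>. The
  remaining \<open>b\<close> makes the inequalities strict. The two conditions are independent.
\<close>

lemma survival_lower_bound:
  assumes "0 < t" "0 \<le> v" "0 < b"
  shows "prob {\<omega>\<in>space M. \<alpha> * t + v + 2 * b \<le> X0 \<omega>} * (1 - 2 * exp (1 / 2 - b / sqrt t))
    \<le> prob {\<omega>\<in>space M. v < X t \<omega> \<and> ereal t < \<tau> \<omega>}"
proof -
  let ?a = "{\<omega>\<in>space M. \<alpha> * t + v + 2 * b \<le> X0 \<omega>}"
  let ?b = "{\<omega>\<in>space M. \<forall>q\<in>\<rat> \<inter> {0..t}. - b \<le> B q \<omega>}"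
  let ?P = "\<Pi>\<^sub>M t\<in>{0..}. borel :: real measure"
  have "{f\<in>space ?P. \<forall>q\<in>\<rat> \<inter> {0..t}. - b \<le> f q} \<in> sets ?P" (is "?E \<in> _")
  proof (rule sets.sets_Collect_countable_All')
    show "countable (\<rat> \<inter> {0..t})" using countable_rat by auto
    fix q assume "q \<in> \<rat> \<inter> {0..t}"
    then have "(\<lambda>f. f q) \<in> borel_measurable ?P" by (intro measurable_component_singleton) auto
    then show "{f\<in>space ?P. - b \<le> f q} \<in> sets ?P" by simp
  qed
  from indep_X0_path[OF _ this, of "{\<alpha> * t + v + 2 * b..}"]
  have "prob ((X0 -` {\<alpha> * t + v + 2 * b..} \<inter> space M) \<inter> ((\<lambda>\<omega>. \<lambda>t\<in>{0..}. B t \<omega>) -` ?E \<inter> space M))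
    = prob (X0 -` {\<alpha> * t + v + 2 * b..} \<inter> space M) * prob ((\<lambda>\<omega>. \<lambda>t\<in>{0..}. B t \<omega>) -` ?E \<inter> space M)"
    by simp
  moreover have "X0 -` {\<alpha> * t + v + 2 * b..} \<inter> space M = ?a" by auto
  moreover have "(\<lambda>\<omega>. \<lambda>t\<in>{0..}. B t \<omega>) -` ?E \<inter> space M = ?b" by (auto simp: space_PiM)
  ultimately have ind: "prob (?a \<inter> ?b) = prob ?a * prob ?b" by simp
  have "prob ?a * (1 - 2 * exp (1 / 2 - b / sqrt t)) \<le> prob (?a \<inter> ?b)"
    unfolding ind by (intro mult_left_mono minimum_over_rationals \<open>0 < t\<close>) simp
  also have "\<dots> \<le> prob {\<omega>\<in>space M. v < X t \<omega> \<and> ereal t < \<tau> \<omega>}"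
  proof (rule finite_measure_mono)
    show "?a \<inter> ?b \<subseteq> {\<omega>\<in>space M. v < X t \<omega> \<and> ereal t < \<tau> \<omega>}"
    proof safe
      fix \<omega> assume \<omega>: "\<omega> \<in> space M" "\<alpha> * t + v + 2 * b \<le> X0 \<omega>"
        and q: "\<forall>q\<in>\<rat> \<inter> {0..t}. - b \<le> B q \<omega>"
      have "continuous_on {0..t} (\<lambda>s. B s \<omega>)"
        by (rule continuous_on_subset[OF continuous_B[OF \<omega>(1)]]) auto
      from ball_atLeastAtMost_iff_rationals[OF this \<open>0 < t\<close>, of "- b"] q
      have low: "- b \<le> B s \<omega>" if "s \<in> {0..t}" for s using that by blast
      have pos: "v < X s \<omega>" if "s \<in> {0..t}" for s
      proof -
        have "\<alpha> * s \<le> \<alpha> * t" using that drift_pos by simp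
        then show ?thesis using low[OF that] \<omega>(2) \<open>0 < b\<close> by (simp add: drifted_def)
      qed
      then show "v < X t \<omega>" using \<open>0 < t\<close> by simp
      show "ereal t < \<tau> \<omega>"
        using hitting_time_0_gt_iff[of X \<omega> t] continuous_X[OF \<omega>(1)] pos \<open>0 < t\<close> \<open>0 \<le> v\<close> by fastforce
    qed
    have "{\<omega>\<in>space M. v < X t \<omega> \<and> ereal t < \<tau> \<omega>}
        = {\<omega>\<in>space M. v < X t \<omega>} \<inter> {\<omega>\<in>space M. ereal t < \<tau> \<omega>}" by auto
    then show "{\<omega>\<in>space M. v < X t \<omega> \<and> ereal t < \<tau> \<omega>} \<in> events"
      using measurable_survival[OF \<open>0 < t\<close>] random_variable_X[of t] \<open>0 < t\<close> by simp
  qed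
  finally show ?thesis .
qed

end

section \<open>Survival with a heavy-tailed start\<close>

locale heavy_tailed_start = drifted_brownian_motion M B X0 \<alpha> + moderate_hazard F x0
  for M :: "'a measure" and B X0 \<alpha> F x0 +
  assumes tail_X0: "\<And>x. 0 \<le> x \<Longrightarrow> prob {\<omega>\<in>space M. x \<le> X0 \<omega>} = exp (- F x)"
begin

text \<open>
  Condition on \<open>B t = y\<close>: the start must then exceed \<open>x - y\<close>, which costs at most
  \<open>exp (- F x) * exp (2 * deriv F x * y)\<close>. It remains to integrate the second factor against the
  Gaussian law on \<open>y > b\<close>, and the tilt \<open>1 / sqrt t\<close> gives a bound in terms of \<open>deriv F x * sqrt t\<close> and
  \<open>b / sqrt t\<close> only.
\<close>

lemma moderate_fluctuation_bound:
  assumes "0 < t" "2 * x0 \<le> x" "0 \<le> b"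
  shows "prob {\<omega>\<in>space M. x - B t \<omega> < X0 \<omega> \<and> b < B t \<omega> \<and> B t \<omega> \<le> x / 2}
    \<le> exp (- F x) * exp ((2 * deriv F x * sqrt t + 1)\<^sup>2 / 2 - b / sqrt t)"
proof -
  let ?A = "{p. x - fst p < snd p \<and> b < fst p \<and> fst p \<le> x / 2} :: (real \<times> real) set"
  have "{p \<in> space (borel \<Otimes>\<^sub>M borel). x - fst p < snd p \<and> b < fst p \<and> fst p \<le> x / 2}
      \<in> sets (borel \<Otimes>\<^sub>M borel :: (real \<times> real) measure)" by measurable
  then have A: "?A \<in> sets (borel \<Otimes>\<^sub>M borel)" by (simp add: space_pair_measure)
  have "emeasure M {\<omega>\<in>space M. (B t \<omega>, X0 \<omega>) \<in> ?A}
      = (\<integral>\<^sup>+y. emeasure M {\<omega>\<in>space M. (y, X0 \<omega>) \<in> ?A} \<partial>distr M borel (B t))"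
    using assms by (intro emeasure_indep_var_slices[OF indep_var_B_X0 A]) simp
  also have "\<dots> \<le> (\<integral>\<^sup>+y. ennreal (exp (- F x)) * (ennreal (exp (2 * deriv F x * y)) * indicator {b<..} y)
      \<partial>distr M borel (B t))"
  proof (rule nn_integral_mono)
    fix y
    show "emeasure M {\<omega>\<in>space M. (y, X0 \<omega>) \<in> ?A}
        \<le> ennreal (exp (- F x)) * (ennreal (exp (2 * deriv F x * y)) * indicator {b<..} y)"
    proof (cases "b < y \<and> y \<le> x / 2")
      case True
      then have y: "0 \<le> y" "y \<le> x / 2" "0 \<le> x - y" using assms by auto
      have "prob {\<omega>\<in>space M. (y, X0 \<omega>) \<in> ?A} \<le> prob {\<omega>\<in>space M. x - y \<le> X0 \<omega>}"
        by (rule finite_measure_mono) (use random_variable_X0 in auto)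
      also have "\<dots> = exp (- F (x - y))" using y by (intro tail_X0)
      also have "\<dots> \<le> exp (- F x) * exp (2 * deriv F x * y)"
        using exponent_lower_bound[OF assms(2) y(1,2)] by (simp add: exp_add[symmetric])
      finally show ?thesis
        using True by (simp add: emeasure_eq_measure ennreal_mult'[symmetric] ennreal_leI)
    next
      case False
      then have "{\<omega>\<in>space M. (y, X0 \<omega>) \<in> ?A} = {}" by auto
      then show ?thesis by (simp only: emeasure_empty zero_le)
    qed
  qed
  also have "\<dots> = ennreal (exp (- F x)) * (\<integral>\<^sup>+y. ennreal (exp (2 * deriv F x * y)) * indicator {b<..} y
      \<partial>density lborel (normal_density 0 (sqrt t)))"
    unfolding distr_B[OF \<open>0 < t\<close>] by (rule nn_integral_cmult) simp
  also have "\<dots> \<le> ennreal (exp (- F x)) *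
      ennreal (exp ((2 * deriv F x + 1 / sqrt t)\<^sup>2 * (sqrt t)\<^sup>2 / 2 - 1 / sqrt t * b))"
    using \<open>0 < t\<close> by (intro mult_left_mono nn_integral_exp_normal_tail) auto
  also have "(2 * deriv F x + 1 / sqrt t)\<^sup>2 * (sqrt t)\<^sup>2 = (2 * deriv F x * sqrt t + 1)\<^sup>2"
    unfolding power_mult_distrib[symmetric] using \<open>0 < t\<close> by (simp add: distrib_right)
  finally show ?thesis by (simp add: emeasure_eq_measure ennreal_mult'[symmetric])
qed

text \<open>
  The three terms belong to \<open>B t \<le> b\<close>, \<open>b < B t \<le> \<alpha> * t / 2\<close> and \<open>\<alpha> * t / 2 < B t\<close>.
  The last is the Chernoff bound with parameter \<open>\<alpha> / 2\<close>.
\<close>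

lemma exceedance_upper_bound:
  assumes "0 < t" "2 * x0 \<le> \<alpha> * t" "0 \<le> v" "0 \<le> b" "b \<le> \<alpha> * t"
  shows "prob {\<omega>\<in>space M. v < X t \<omega> \<and> ereal t < \<tau> \<omega>}
    \<le> exp (- F (\<alpha> * t + v - b))
      + exp (- F (\<alpha> * t)) * exp ((2 * deriv F (\<alpha> * t) * sqrt t + 1)\<^sup>2 / 2 - b / sqrt t)
      + exp (- (\<alpha> / 8 * (\<alpha> * t)))"
proof -
  let ?x = "\<alpha> * t"
  let ?a = "{\<omega>\<in>space M. ?x + v - b \<le> X0 \<omega>}"
  let ?b = "{\<omega>\<in>space M. ?x - B t \<omega> < X0 \<omega> \<and> b < B t \<omega> \<and> B t \<omega> \<le> ?x / 2}"
  let ?c = "{\<omega>\<in>space M. ?x / 2 < B t \<omega>}"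
  note [measurable] = random_variable_X0
  have [measurable]: "B t \<in> borel_measurable M" using \<open>0 < t\<close> by (intro random_variable_B) simp
  have meas: "?a \<in> events" "?b \<in> events" "?c \<in> events" by measurable
  have "prob {\<omega>\<in>space M. v < X t \<omega> \<and> ereal t < \<tau> \<omega>} \<le> prob (?a \<union> ?b \<union> ?c)"
    using meas by (intro finite_measure_mono) (use \<open>0 \<le> v\<close> in \<open>auto simp: drifted_def\<close>)
  also have "\<dots> \<le> prob (?a \<union> ?b) + prob ?c" using meas by (intro measure_Un_le) auto
  also have "prob (?a \<union> ?b) \<le> prob ?a + prob ?b" using meas by (intro measure_Un_le) auto
  also have "prob ?a = exp (- F (?x + v - b))" using assms by (intro tail_X0) simp
  also have "prob ?b \<le> exp (- F ?x) * exp ((2 * deriv F ?x * sqrt t + 1)\<^sup>2 / 2 - b / sqrt t)"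
    using assms by (intro moderate_fluctuation_bound)
  also have "prob ?c \<le> exp ((\<alpha> / 2)\<^sup>2 * (sqrt t)\<^sup>2 / 2 - \<alpha> / 2 * (?x / 2))"
    using \<open>0 < t\<close> drift_pos by (intro normal_chernoff_bound distributed_B) auto
  also have "(\<alpha> / 2)\<^sup>2 * (sqrt t)\<^sup>2 / 2 - \<alpha> / 2 * (?x / 2) = - (\<alpha> / 8 * ?x)"
    using \<open>0 < t\<close> by (simp add: power2_eq_square field_simps)
  finally show ?thesis by simp
qed

lemma at_top_drift: "filterlim (\<lambda>t. \<alpha> * t) at_top at_top"
  using drift_pos by real_asymp

text \<open>
  Brownian displacements up to time \<open>t\<close> are negligible on the overshoot scale.
\<close>

lemma hazard_scale_vs_sqrt:
  shows "((\<lambda>t. deriv F (\<alpha> * t) * sqrt t) \<longlongrightarrow> 0) at_top"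
    and "\<delta> > 0 \<Longrightarrow> filterlim (\<lambda>t. \<delta> / deriv F (\<alpha> * t) / sqrt t) at_top at_top"
proof -
  have "((\<lambda>t. sqrt (\<alpha> * t) * deriv F (\<alpha> * t) / sqrt \<alpha>) \<longlongrightarrow> 0 / sqrt \<alpha>) at_top"
    using filterlim_compose[OF sqrt_hazard_tendsto_0 at_top_drift] drift_pos
    by (intro tendsto_intros) auto
  then show lim: "((\<lambda>t. deriv F (\<alpha> * t) * sqrt t) \<longlongrightarrow> 0) at_top"
    using drift_pos by (simp add: real_sqrt_mult mult.commute mult.left_commute)
  assume "\<delta> > 0"
  have "\<forall>\<^sub>F t in at_top. 0 < deriv F (\<alpha> * t) * sqrt t"
    using eventually_gt_at_top[of 0] filterlim_at_top[THEN iffD1, OF at_top_drift, rule_format, of x0]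
    by eventually_elim (use hazard_pos in auto)
  with lim have "filterlim (\<lambda>t. deriv F (\<alpha> * t) * sqrt t) (at_right 0) at_top"
    by (rule tendsto_imp_filterlim_at_right)
  with \<open>\<delta> > 0\<close> have "filterlim (\<lambda>t. \<delta> * inverse (deriv F (\<alpha> * t) * sqrt t)) at_top at_top"
    by (intro filterlim_tendsto_pos_mult_at_top[OF tendsto_const]
        filterlim_compose[OF filterlim_inverse_at_top_right]) auto
  then show "filterlim (\<lambda>t. \<delta> / deriv F (\<alpha> * t) / sqrt t) at_top at_top"
    by (simp add: field_simps)
qed

text \<open>
  Multiplied by \<open>exp (F (\<alpha> * t))\<close>, the lower and upper bounds with \<open>b = \<delta> / deriv F (\<alpha> * t)\<close> converge to
  \<open>exp (- (\<kappa> + 2 * \<delta>))\<close> and \<open>exp (- (\<kappa> - \<delta>))\<close>.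
\<close>

lemma survival_asymptotics:
  assumes "0 \<le> \<kappa>"
  shows "((\<lambda>t. exp (F (\<alpha> * t)) *
      prob {\<omega>\<in>space M. \<kappa> / deriv F (\<alpha> * t) < X t \<omega> \<and> ereal t < \<tau> \<omega>}) \<longlongrightarrow> exp (- \<kappa>)) at_top"
    (is "((\<lambda>t. ?f t) \<longlongrightarrow> _) _")
proof (rule squeeze_family)
  let ?r = "\<lambda>\<delta> t. \<delta> / deriv F (\<alpha> * t) / sqrt t"
  let ?I = "\<lambda>\<kappa> t. F (\<alpha> * t + \<kappa> / deriv F (\<alpha> * t)) - F (\<alpha> * t)"
  let ?l = "\<lambda>\<delta> t. exp (- ?I (\<kappa> + 2 * \<delta>) t) * (1 - 2 * exp (1 / 2 - ?r \<delta> t))"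
  let ?u = "\<lambda>\<delta> t. exp (- ?I (\<kappa> - \<delta>) t) + exp ((2 * (deriv F (\<alpha> * t) * sqrt t) + 1)\<^sup>2 / 2 - ?r \<delta> t)
      + exp (- (\<alpha> / 8 * (\<alpha> * t) - F (\<alpha> * t)))"
  have I: "(?I k \<longlongrightarrow> k) at_top" for k
    by (rule filterlim_compose[OF exponent_increment_tendsto at_top_drift])
  have exp_minus_0: "((\<lambda>t. exp (- g t)) \<longlongrightarrow> 0) at_top" if "filterlim g at_top at_top" for g :: "real \<Rightarrow> real"
    using that by (intro filterlim_compose[OF exp_at_bot] filterlim_compose[OF filterlim_uminus_at_bot_at_top])
  {
    fix \<delta> :: real assume "\<delta> > 0"
    have r: "((\<lambda>t. exp (- ?r \<delta> t)) \<longlongrightarrow> 0) at_top"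
      using \<open>\<delta> > 0\<close> by (intro exp_minus_0 hazard_scale_vs_sqrt)
    have "((\<lambda>t. exp (- ?I (\<kappa> + 2 * \<delta>) t) * (1 - 2 * (exp (1 / 2) * exp (- ?r \<delta> t))))
        \<longlongrightarrow> exp (- (\<kappa> + 2 * \<delta>)) * (1 - 2 * (exp (1 / 2) * 0))) at_top"
      by (intro tendsto_intros I r)
    then show "(?l \<delta> \<longlongrightarrow> exp (- (\<kappa> + 2 * \<delta>))) at_top"
      by (simp add: exp_add[symmetric])
    have "((\<lambda>t. exp (- ?I (\<kappa> - \<delta>) t)
        + exp ((2 * (deriv F (\<alpha> * t) * sqrt t) + 1)\<^sup>2 / 2) * exp (- ?r \<delta> t)
        + exp (- (\<alpha> / 8 * (\<alpha> * t) - F (\<alpha> * t))))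
        \<longlongrightarrow> exp (- (\<kappa> - \<delta>)) + exp ((2 * 0 + 1)\<^sup>2 / 2) * 0 + 0) at_top"
      by (intro tendsto_add tendsto_mult I r exp_minus_0 tendsto_exp tendsto_minus tendsto_divide
            tendsto_power tendsto_const hazard_scale_vs_sqrt
            filterlim_compose[OF exponent_sublinear at_top_drift])
        (use drift_pos in auto)
    then show "(?u \<delta> \<longlongrightarrow> exp (- (\<kappa> - \<delta>))) at_top"
      by (simp add: exp_add[symmetric])
    have "\<forall>\<^sub>F t in at_top. \<delta> / deriv F (\<alpha> * t) / (\<alpha> * t) < 1"
      by (rule order_tendstoD(2)[OF filterlim_compose[OF scaled_hazard_step_tendsto_0 at_top_drift]]) simp
    then show "\<forall>\<^sub>F t in at_top. ?l \<delta> t \<le> ?f t \<and> ?f t \<le> ?u \<delta> t"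
      using eventually_gt_at_top[of 0]
        filterlim_at_top[THEN iffD1, OF at_top_drift, rule_format, of "2 * x0"]
    proof eventually_elim
      case (elim t)
      define p where "p = deriv F (\<alpha> * t)"
      have "0 < \<alpha> * t" using elim drift_pos by simp
      have "0 < p" unfolding p_def using elim x0_pos by (intro hazard_pos) simp
      have b: "0 \<le> \<kappa> / p" "0 < \<delta> / p" "\<delta> / p \<le> \<alpha> * t"
        using \<open>0 < p\<close> \<open>\<delta> > 0\<close> assms elim(1) \<open>0 < \<alpha> * t\<close> divide_less_eq_1_pos[OF \<open>0 < \<alpha> * t\<close>, of "\<delta> / p"]
        by (simp_all add: p_def)
      have "exp (- F (\<alpha> * t + \<kappa> / p + 2 * (\<delta> / p))) * (1 - 2 * exp (1 / 2 - \<delta> / p / sqrt t))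
          \<le> prob {\<omega>\<in>space M. \<kappa> / p < X t \<omega> \<and> ereal t < \<tau> \<omega>}"
        using survival_lower_bound[OF elim(2) b(1,2)] b \<open>0 < \<alpha> * t\<close> by (simp add: tail_X0)
      then have "exp (F (\<alpha> * t)) * (exp (- F (\<alpha> * t + \<kappa> / p + 2 * (\<delta> / p))) * (1 - 2 * exp (1 / 2 - \<delta> / p / sqrt t)))
          \<le> exp (F (\<alpha> * t)) * prob {\<omega>\<in>space M. \<kappa> / p < X t \<omega> \<and> ereal t < \<tau> \<omega>}"
        by (rule mult_left_mono) simp
      also have "exp (F (\<alpha> * t)) * (exp (- F (\<alpha> * t + \<kappa> / p + 2 * (\<delta> / p))) * (1 - 2 * exp (1 / 2 - \<delta> / p / sqrt t)))
          = ?l \<delta> t"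
        unfolding mult.assoc[symmetric] exp_add[symmetric] by (simp add: p_def add_divide_distrib add.assoc)
      finally have lower: "?l \<delta> t \<le> ?f t" by (simp add: p_def)
      have "prob {\<omega>\<in>space M. \<kappa> / p < X t \<omega> \<and> ereal t < \<tau> \<omega>}
          \<le> exp (- F (\<alpha> * t + \<kappa> / p - \<delta> / p))
            + exp (- F (\<alpha> * t)) * exp ((2 * p * sqrt t + 1)\<^sup>2 / 2 - \<delta> / p / sqrt t)
            + exp (- (\<alpha> / 8 * (\<alpha> * t)))"
        unfolding p_def by (rule exceedance_upper_bound) (use elim b in \<open>auto simp: p_def\<close>)
      then have "exp (F (\<alpha> * t)) * prob {\<omega>\<in>space M. \<kappa> / p < X t \<omega> \<and> ereal t < \<tau> \<omega>}
          \<le> exp (F (\<alpha> * t)) * (exp (- F (\<alpha> * t + \<kappa> / p - \<delta> / p))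
            + exp (- F (\<alpha> * t)) * exp ((2 * p * sqrt t + 1)\<^sup>2 / 2 - \<delta> / p / sqrt t)
            + exp (- (\<alpha> / 8 * (\<alpha> * t))))"
        by (rule mult_left_mono) simp
      also have "\<dots> = ?u \<delta> t"
        unfolding distrib_left mult.assoc[symmetric] exp_add[symmetric]
        by (simp add: p_def diff_divide_distrib add_diff_eq mult.assoc)
      finally have upper: "?f t \<le> ?u \<delta> t" by (simp add: p_def)
      from lower upper show ?case ..
    qed
  }
  show "((\<lambda>\<delta>. exp (- (\<kappa> + 2 * \<delta>))) \<longlongrightarrow> exp (- \<kappa>)) (at_right 0)"
    by (auto intro!: tendsto_eq_intros)
  show "((\<lambda>\<delta>. exp (- (\<kappa> - \<delta>))) \<longlongrightarrow> exp (- \<kappa>)) (at_right 0)"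
    by (auto intro!: tendsto_eq_intros)
qed

end

theorem theorem8:
  fixes M :: "'a measure"
    and B :: "real \<Rightarrow> 'a \<Rightarrow> real"
    and X0 :: "'a \<Rightarrow> real"
    and \<mu> :: "real measure"
    and F :: "real \<Rightarrow> real"
    and \<alpha> \<beta> c :: real
  assumes "\<alpha> > 0"
    and "prob_space \<mu>" and "sets \<mu> = sets borel" and "measure \<mu> {0..} = 1"
    and "\<And>x. 0 \<le> x \<Longrightarrow> measure \<mu> {x..} = exp (- F x)"
    and "strict_mono_on {0..} F"
    and "smoothly_varying \<beta> F"
    and "0 < \<beta>" and "\<beta> < 1 / 2"
    and "brownian_motion M B"
    and "X0 \<in> borel_measurable M" and "distr M borel X0 = \<mu>"
    and "prob_space.indep_set M
           (sets (vimage_algebra (space M) X0 borel))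
           (sets (vimage_algebra (space M) (\<lambda>\<omega>. \<lambda>t\<in>{0..}. B t \<omega>) (\<Pi>\<^sub>M t\<in>{0..}. borel)))"
    and "c > 0"
  shows "((\<lambda>t. \<P>(\<omega> in M. absorbed_at_0 (drifted \<alpha> X0 B) t \<omega> > c / deriv F (\<alpha> * t)
                 \<bar> hitting_time_0 (drifted \<alpha> X0 B) \<omega> > ereal t))
           \<longlongrightarrow> exp (- c)) at_top"
proof -
  interpret brownian_motion M B by fact
  have tail: "prob {\<omega>\<in>space M. x \<le> X0 \<omega>} = measure \<mu> {x..}" for x
  proof -
    have "X0 -` {x..} \<inter> space M = {\<omega>\<in>space M. x \<le> X0 \<omega>}" by auto
    then show ?thesis
      using assms(11) by (simp add: assms(12)[symmetric] measure_distr)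
  qed
  have "prob {\<omega>\<in>space M. 0 \<le> X0 \<omega>} = 1" using tail[of 0] assms(4) by simp
  then have nonneg: "AE \<omega> in M. 0 \<le> X0 \<omega>"
    using prob_Collect_eq_1[of "\<lambda>\<omega>. 0 \<le> X0 \<omega>"] assms(11) by simp
  obtain x0 where x0: "moderate_hazard F x0"
    using smoothly_varying_imp_moderate_hazard[OF assms(7-9)] .
  interpret moderate_hazard F x0 by fact
  interpret heavy_tailed_start M B X0 \<alpha> F x0
    by unfold_locales (use assms tail nonneg in auto)
  let ?P = "\<lambda>\<kappa> t. prob {\<omega>\<in>space M. \<kappa> / deriv F (\<alpha> * t) < X t \<omega> \<and> ereal t < \<tau> \<omega>}"
  have "((\<lambda>t. (exp (F (\<alpha> * t)) * ?P c t) / (exp (F (\<alpha> * t)) * ?P 0 t)) \<longlongrightarrow> exp (- c) / exp (- 0)) at_top"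
    using \<open>c > 0\<close> by (intro tendsto_divide survival_asymptotics) auto
  then have lim: "((\<lambda>t. ?P c t / ?P 0 t) \<longlongrightarrow> exp (- c)) at_top" by simp
  have "\<forall>\<^sub>F t in at_top. ?P c t / ?P 0 t
      = \<P>(\<omega> in M. absorbed_at_0 X t \<omega> > c / deriv F (\<alpha> * t) \<bar> \<tau> \<omega> > ereal t)"
    using eventually_gt_at_top[of 0]
  proof eventually_elim
    case (elim t)
    have "{\<omega>\<in>space M. c / deriv F (\<alpha> * t) < X t \<omega> \<and> ereal t < \<tau> \<omega>}
        = {\<omega>\<in>space M. absorbed_at_0 X t \<omega> > c / deriv F (\<alpha> * t) \<and> \<tau> \<omega> > ereal t}"
      by (auto simp: absorbed_at_0_def)
    with survival_prob_eq[OF elim] show ?case by (simp add: cond_prob_def)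
  qed
  with lim show ?thesis by (rule Lim_transform_eventually)
qed

end
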